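(* Let $\Omega,\mathcal H,\Gamma,t,T,L,C_i,C_j,\varepsilon_i,\varepsilon_j,\tau_i,\tau_j,B_i,B_j,P_i,P_j$ satisfy all the conditions of the common bi-Lipschitz random map setting described in the context. For probability laws $\mu,\nu$ on $\mathcal H$ with finite second moment let $$W_{2,\Gamma}^2(\mu,\nu)=\inf_{\gamma}\int\|\Gamma^{1/2}b-\Gamma^{1/2}b'\|^2\,d\gamma(b,b'),$$ the infimum being over all couplings $\gamma$ of $\mu$ and $\nu$. For a coupling $\pi$ of $P_i$ and $P_j$, let $(B_i,B_j)\sim\pi$, $Z_i=\Gamma^{1/2}B_i$, $Z_j=\Gamma^{1/2}B_j$, $\kappa_\pi=\mathbb E_\pi\langle Z_i,Z_j\rangle_{\mathcal H}$, and let $v_i=\mathbb E\|Z_i\|^2$, $v_j=\mathbb E\|Z_j\|^2$. Let $\check P_j:=(-I)_\#P_j$ be the pushforward of $P_j$ under $b\mapsto -b$. Then the least value of $\kappa_\pi$ attainable over the set of all couplings $\pi$ of $P_i$ and $P_j$ is $$\underline\kappa_{ij}=\tfrac12\bigl(W_{2,\Gamma}^2(P_i,\check P_j)-v_i-v_j\bigr).$$ That is, $\kappa_\pi\ge\underline\kappa_{ij}$ for every coupling $\pi$ of $P_i$ and $P_j$, with equality for some coupling.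
   Context: Common bi-Lipschitz random map setting. $(\Omega,d_\Omega)$ is a Polish metric space with its Borel $\sigma$-algebra; $\mathcal P_2(\Omega)$ is the set of Borel probability measures $C$ on $\Omega$ with $\int_\Omega d_\Omega(\omega,\omega_0)^2\,C(d\omega)<\infty$ for some (equivalently any) $\omega_0\in\Omega$. $\mathcal H$ is a real separable Hilbert space; $\Gamma:\mathcal H\to\mathcal H$ is a bounded, positive, self-adjoint operator and $\Gamma^{1/2}$ is its unique bounded positive square root. The common carrier $t:\Omega\to\mathcal H$ is Borel measurable, and $t_\Gamma:=\Gamma^{1/2}\circ t$ is a Borel embedding with a Borel inverse on its image. For some $L\ge 1$ and all $x,y\in\Omega$, $$L^{-1}d_\Omega(x,y)\le\|t_\Gamma(x)-t_\Gamma(y)\|_{\mathcal H}\le L\,d_\Omega(x,y).$$ $\mathcal U$ is a measurable space and $T:\Omega\times\mathcal U\to\mathcal H$ is (Borel) measurable. $C_i,C_j\in\mathcal P_2(\Omega)$ are the characteristic laws of two firms $i,j$. For $k\in\{i,j\}$, $X_k\sim C_k$, $U_k$ is a $\mathcal U$-valued transmission draw with a law common to both firms, and the exposure random element is $$B_k=T(X_k,U_k)=t(X_k)+\varepsilon_k(X_k,U_k),$$ where $\varepsilon_k:\Omega\times\mathcal U\to\mathcal H$ is Borel measurable with $\|\Gamma^{1/2}\varepsilon_k(x,u)\|_{\mathcal H}\le\tau_k$ for all $(x,u)$, for a constant $\tau_k\ge0$. The exposure law is $P_k:=\mathcal L(B_k)$; equivalently $P_k=C_kK$ for the stochastic kernel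 $K(x,\cdot)=\mathcal L(T(x,U))$ with $U$ a transmission draw. It is assumed that $P_i,P_j\in\mathcal P_2(\mathcal H)$, i.e. $P_i$ and $P_j$ have finite second moment (hence also finite $\Gamma$-weighted second moment). *)

theory Defs
  imports "HOL-Probability.Probability"
begin

definition positive_operator :: "('h::real_inner \<Rightarrow> 'h) \<Rightarrow> bool" where
  "positive_operator A \<longleftrightarrow> bounded_linear A \<and>
     (\<forall>x y. inner (A x) y = inner x (A y)) \<and> (\<forall>x. 0 \<le> inner (A x) x)"

text \<open>On a Hilbert space every positive operator has exactly one positive square root,
  so the description below is proper there.\<close>

definition op_sqrt :: "('h::real_inner \<Rightarrow> 'h) \<Rightarrow> 'h \<Rightarrow> 'h" where
  "op_sqrt A = (THE S. positive_operator S \<and> S \<circ> S = A)"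

definition borel_embedding :: "('a::topological_space \<Rightarrow> 'b::topological_space) \<Rightarrow> bool" where
  "borel_embedding f \<longleftrightarrow> f \<in> measurable borel borel \<and> inj f \<and>
     inv f \<in> measurable (restrict_space borel (range f)) borel"

definition P2 :: "'a::metric_space measure set" where
  "P2 = {\<mu>. prob_space \<mu> \<and> sets \<mu> = sets borel \<and>
     (\<exists>x0. (\<integral>\<^sup>+ x. ennreal ((dist x x0)\<^sup>2) \<partial>\<mu>) < \<infinity>)}"

definition couplings :: "'a measure \<Rightarrow> 'b measure \<Rightarrow> ('a \<times> 'b) measure set" where
  "couplings \<mu> \<nu> = {\<pi>. prob_space \<pi> \<and> sets \<pi> = sets (\<mu> \<Otimes>\<^sub>M \<nu>) \<and>
     distr \<pi> \<mu> fst = \<mu> \<and> distr \<pi> \<nu> snd = \<nu>}"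

text \<open>The square of the weighted Wasserstein distance. The infimum is taken in
  \<^typ>\<open>ennreal\<close>; it is finite for two laws in \<^const>\<open>P2\<close> when \<^term>\<open>G\<close> is a positive
  operator on a Hilbert space.\<close>

definition W2_sq :: "('h::real_inner \<Rightarrow> 'h) \<Rightarrow> 'h measure \<Rightarrow> 'h measure \<Rightarrow> real" where
  "W2_sq G \<mu> \<nu> = enn2real (INF \<gamma>\<in>couplings \<mu> \<nu>.
     \<integral>\<^sup>+ (b, b'). ennreal ((norm (op_sqrt G b - op_sqrt G b'))\<^sup>2) \<partial>\<gamma>)"

definition kappa :: "('h::real_inner \<Rightarrow> 'h) \<Rightarrow> ('h \<times> 'h) measure \<Rightarrow> real" where
  "kappa G \<pi> = (\<integral>(b, b'). inner (op_sqrt G b) (op_sqrt G b') \<partial>\<pi>)"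

definition weighted_moment :: "('h::real_inner \<Rightarrow> 'h) \<Rightarrow> 'h measure \<Rightarrow> real" where
  "weighted_moment G \<mu> = (\<integral>b. (norm (op_sqrt G b))\<^sup>2 \<partial>\<mu>)"

definition kappa_lower :: "('h::real_inner \<Rightarrow> 'h) \<Rightarrow> 'h measure \<Rightarrow> 'h measure \<Rightarrow> real" where
  "kappa_lower G \<mu> \<nu> =
     (W2_sq G \<mu> (distr \<nu> borel uminus) - weighted_moment G \<mu> - weighted_moment G \<nu>) / 2"

text \<open>
  The setting attached to one firm: \<open>X\<close> is the characteristic with law \<open>C\<close>, \<open>U\<close> the
  transmission draw, \<open>e\<close> and \<open>\<tau>\<close> the perturbation and its bound, \<open>P\<close> the exposure law.
  Independence of \<open>X\<close> and \<open>U\<close> is what makes \<open>P\<close> the image of \<open>C\<close> under the kernel sending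
  \<open>x\<close> to the law of \<open>T (x, U)\<close>; it is stated for the generated \<open>\<sigma>\<close>-algebras because
  \<^const>\<open>prob_space.indep_var\<close> requires both variables to have the same codomain type.
  \<open>\<U>\<close> only serves as a measurable space.
\<close>

locale firm = prob_space M
  for M :: "'m measure" +
  fixes \<U> :: "'u measure"
    and G :: "'h::{real_inner, polish_space} \<Rightarrow> 'h"
    and t :: "'o::polish_space \<Rightarrow> 'h"
    and T :: "'o \<times> 'u \<Rightarrow> 'h"
    and C :: "'o measure"
    and X :: "'m \<Rightarrow> 'o"
    and U :: "'m \<Rightarrow> 'u"
    and e :: "'o \<times> 'u \<Rightarrow> 'h"
    and \<tau> :: real
    and P :: "'h measure"
  assumes C: "C \<in> P2"
    and X: "X \<in> measurable M borel" "distr M borel X = C"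
    and U: "U \<in> measurable M \<U>"
    and indep: "indep_set (sets (vimage_algebra (space M) X borel))
                          (sets (vimage_algebra (space M) U \<U>))"
    and e: "e \<in> measurable (borel \<Otimes>\<^sub>M \<U>) borel"
    and decomposition: "AE \<omega> in M. T (X \<omega>, U \<omega>) = t (X \<omega>) + e (X \<omega>, U \<omega>)"
    and \<tau>: "0 \<le> \<tau>" "\<And>x u. u \<in> space \<U> \<Longrightarrow> norm (op_sqrt G (e (x, u))) \<le> \<tau>"
    and P: "P = distr M borel (\<lambda>\<omega>. T (X \<omega>, U \<omega>))" "P \<in> P2"

end

theory Submission
  imports Defs
begin

text \<open>
  Flipping the sign of the second coordinate of a coupling \<open>\<pi>\<close> gives a plan with transport cost
  \<open>v\<^sub>i + v\<^sub>j + 2 \<kappa>\<^sub>\<pi>\<close>, so the claim amounts to the existence of a coupling that minimizes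
  \<open>\<kappa>\<^sub>\<pi>\<close>. The square root of \<open>\<Gamma>\<close> comes from the iteration
  \<open>Y \<mapsto> (A + Y\<^sup>2) / 2\<close> with \<open>A = 1 - \<Gamma> / c\<close>, whose increments are dominated by those of the
  scalar iteration \<open>y \<mapsto> (1 + y\<^sup>2) / 2\<close>.
  For the minimizer, view couplings as points of the compact space of \<open>[0, 1]\<close>-valued set
  functions. A minimizing sequence has a cluster point there; it is finitely additive, and the
  inner regularity of the two marginals makes it \<open>\<sigma>\<close>-additive on rectangles, so Caratheodory's
  theorem extends it to a coupling. The functional \<open>\<kappa>\<close> is continuous along this convergence,
  because \<open>L\<^sup>2\<close> approximation by simple functions is uniform over all couplings.
\<close>

section \<open>Square roots of positive operators\<close>

primrec root_iter :: "('h::real_vector \<Rightarrow> 'h) \<Rightarrow> nat \<Rightarrow> 'h \<Rightarrow> 'h" where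
  "root_iter A 0 = (\<lambda>x. 0)"
| "root_iter A (Suc n) = (\<lambda>x. (1/2) *\<^sub>R (A x + root_iter A n (root_iter A n x)))"

primrec root_majorant :: "nat \<Rightarrow> real" where
  "root_majorant 0 = 0"
| "root_majorant (Suc n) = (1 + (root_majorant n)\<^sup>2) / 2"

lemma root_majorant_bounds: "0 \<le> root_majorant n \<and> root_majorant n \<le> 1"
proof (induction n)
  case (Suc n)
  then have "(root_majorant n)\<^sup>2 \<le> 1"
    by (simp add: power_le_one)
  then show ?case by simp
qed simp

text \<open>The increment equals half the square of \<open>1 - root_majorant n\<close>.\<close>

lemma root_majorant_Suc_ge: "root_majorant n \<le> root_majorant (Suc n)"
proof -
  have "0 \<le> (1 - root_majorant n)\<^sup>2" by simp
  then show ?thesis by (simp add: power2_eq_square algebra_simps)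
qed

lemma convergent_root_majorant: "convergent root_majorant"
  by (intro Bseq_mono_convergent BseqI'[where K = 1])
     (use root_majorant_bounds in \<open>auto intro!: lift_Suc_mono_le root_majorant_Suc_ge\<close>)

context
  fixes A :: "'h::real_normed_vector \<Rightarrow> 'h"
  assumes linA: "linear A" and contr: "\<And>x. norm (A x) \<le> norm x"
begin

lemma linear_root_iter: "linear (root_iter A n)"
proof (induction n)
  case 0
  show ?case by (auto intro: linearI)
next
  case (Suc n)
  show ?case
    by (rule linearI)
       (simp_all add: linear_add[OF linA] linear_add[OF Suc] linear_scale[OF linA]
         linear_scale[OF Suc] algebra_simps)
qed

text \<open>Each iterate is a polynomial in \<open>A\<close> with nonnegative coefficients, and
  \<open>root_majorant n\<close> is the value of that polynomial at 1; for a contraction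
  \<open>A\<close> this value dominates.\<close>

lemma norm_root_iter_le: "norm (root_iter A n x) \<le> root_majorant n * norm x"
proof (induction n arbitrary: x)
  case (Suc n)
  have *: "norm (root_iter A n (root_iter A n x)) \<le> root_majorant n * (root_majorant n * norm x)"
    using Suc[of "root_iter A n x"] Suc[of x] root_majorant_bounds[of n]
    by (meson mult_left_mono order_trans)
  have "norm (A x + root_iter A n (root_iter A n x))
      \<le> norm x + root_majorant n * (root_majorant n * norm x)"
    using contr[of x] * by (rule norm_triangle_mono)
  also have "\<dots> = 2 * (root_majorant (Suc n) * norm x)"
    by (simp add: power2_eq_square algebra_simps)
  finally show ?case by simp
qed simp

text \<open>The increments are again polynomials in \<open>A\<close> with nonnegative coefficients,
  so the scalar increments dominate them. This reduces convergence of the iterates to convergence of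
  \<open>root_majorant\<close>.\<close>

lemma norm_root_iter_step_le:
  "norm (root_iter A (Suc n) x - root_iter A n x)
     \<le> (root_majorant (Suc n) - root_majorant n) * norm x"
proof (induction n arbitrary: x)
  case 0
  show ?case using contr[of x] by simp
next
  case (Suc n)
  define Y Z b c where defs: "Y = root_iter A n" "Z = root_iter A (Suc n)"
    "b = root_majorant n" "c = root_majorant (Suc n)"
  have b: "0 \<le> b" and bc: "b \<le> c"
    using root_majorant_bounds root_majorant_Suc_ge unfolding defs by auto
  have lin: "linear Z"
    unfolding defs by (rule linear_root_iter)
  have Y: "norm (Y x) \<le> b * norm x" and Z: "\<And>x. norm (Z x) \<le> c * norm x"
    using norm_root_iter_le unfolding defs by blast+
  have step: "\<And>x. norm (Z x - Y x) \<le> (c - b) * norm x"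
    using Suc unfolding defs .
  \<comment> \<open>Operator version of
    \<open>c\<^sup>2 - b\<^sup>2 = c * (c - b) + (c - b) * b\<close>: the difference of squares is
    \<open>Z\<close> after \<open>Z - Y\<close> plus \<open>Z - Y\<close> after
    \<open>Y\<close>.\<close>
  have "norm (Z (Z x) - Y (Y x)) = norm (Z (Z x - Y x) + (Z (Y x) - Y (Y x)))"
    by (simp add: linear_diff[OF lin])
  also have "\<dots> \<le> c * norm (Z x - Y x) + (c - b) * norm (Y x)"
    by (intro norm_triangle_le add_mono Z step)
  also have "\<dots> \<le> c * ((c - b) * norm x) + (c - b) * (b * norm x)"
    using b bc by (intro add_mono mult_left_mono step Y) auto
  finally have main: "norm (Z (Z x) - Y (Y x)) \<le> (c\<^sup>2 - b\<^sup>2) * norm x"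
    by (simp add: power2_eq_square algebra_simps)
  have diff: "norm (root_iter A (Suc (Suc n)) x - root_iter A (Suc n) x)
      = norm (Z (Z x) - Y (Y x)) / 2"
  proof -
    have "root_iter A (Suc (Suc n)) x - root_iter A (Suc n) x
      = (1/2) *\<^sub>R (Z (Z x) - Y (Y x))"
    unfolding defs root_iter.simps(2)[of A "Suc n"] by (simp add: algebra_simps)
    then show ?thesis by (simp del: root_iter.simps)
  qed
  have majorant: "root_majorant (Suc (Suc n)) - root_majorant (Suc n) = (c\<^sup>2 - b\<^sup>2) / 2"
    unfolding defs root_majorant.simps(2)[of "Suc n"] by (simp add: field_simps)
  show ?case
    unfolding diff majorant using main by simp
qed

lemma norm_root_iter_diff_le:
  assumes "n \<le> m"
  shows "norm (root_iter A m x - root_iter A n x) \<le> (root_majorant m - root_majorant n) * norm x"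
  using assms
proof (induction rule: dec_induct)
  case (step k)
  show ?case
    using norm_root_iter_step_le[of k x] step(3)
      norm_triangle_ineq[of "root_iter A (Suc k) x - root_iter A k x"
        "root_iter A k x - root_iter A n x"]
    by (simp add: algebra_simps del: root_iter.simps root_majorant.simps)
qed simp

lemma Cauchy_root_iter: "Cauchy (\<lambda>n. root_iter A n x)"
proof (rule metric_CauchyI)
  fix e :: real assume e: "0 < e"
  have "Cauchy root_majorant"
    by (rule convergent_Cauchy[OF convergent_root_majorant])
  \<comment> \<open>The added 1 keeps the denominator positive when \<open>x = 0\<close>.\<close>
  moreover have "0 < e / (norm x + 1)"
    using e by (simp add: add_nonneg_pos)
  ultimately obtain N where N: "\<And>m n. m \<ge> N \<Longrightarrow> n \<ge> N
      \<Longrightarrow> \<bar>root_majorant m - root_majorant n\<bar> < e / (norm x + 1)"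
    by (metis metric_CauchyD dist_real_def)
  have main: "dist (root_iter A m x) (root_iter A n x) < e" if "n \<ge> N" "n \<le> m" for m n
  proof -
    have "dist (root_iter A m x) (root_iter A n x) \<le> (root_majorant m - root_majorant n) * norm x"
      using norm_root_iter_diff_le[OF that(2)] by (simp add: dist_norm)
    also have "\<dots> \<le> e / (norm x + 1) * norm x"
      using N[of m n] that by (intro mult_right_mono) auto
    also have "\<dots> < e"
      using e by (simp add: divide_less_eq add_nonneg_pos distrib_left)
    finally show ?thesis .
  qed
  show "\<exists>M. \<forall>m\<ge>M. \<forall>n\<ge>M. dist (root_iter A m x) (root_iter A n x) < e"
    by (intro exI[of _ N] allI impI) (metis main dist_commute nle_le)
qed

end

lemma root_iter_symmetric:
  fixes A :: "'h::real_inner \<Rightarrow> 'h"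
  assumes "\<And>x y. inner (A x) y = inner x (A y)"
  shows "inner (root_iter A n x) y = inner x (root_iter A n y)"
proof (induction n arbitrary: x y)
  case (Suc n)
  show ?case
    by (simp add: inner_add assms Suc)
qed simp

text \<open>A polynomial in \<open>A\<close> commutes with whatever commutes with \<open>A\<close>.
  Later \<open>R\<close> is a competing square root, and its commuting with the constructed one
  gives uniqueness.\<close>

lemma root_iter_commute:
  assumes "linear R" "\<And>y. R (A y) = A (R y)"
  shows "R (root_iter A n x) = root_iter A n (R x)"
proof (induction n arbitrary: x)
  case (Suc n)
  show ?case
    by (simp add: linear_scale[OF assms(1)] linear_add[OF assms(1)] assms(2) Suc)
qed (simp add: linear_0[OF assms(1)])

text \<open>The limit \<open>Y\<close> of the iteration satisfies \<open>Y = (A + Y\<^sup>2) / 2\<close>, so that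
  \<open>(1 - Y)\<^sup>2 = 1 - A\<close>.\<close>

lemma contraction_root_fixed_point:
  fixes A :: "'h::{real_inner, complete_space} \<Rightarrow> 'h"
  assumes lin: "linear A" and contr: "\<And>x. norm (A x) \<le> norm x"
    and sym: "\<And>x y. inner (A x) y = inner x (A y)"
  obtains Y where "linear Y" "\<And>x. norm (Y x) \<le> norm x"
    "\<And>x y. inner (Y x) y = inner x (Y y)"
    "\<And>x. 2 *\<^sub>R Y x = A x + Y (Y x)"
    "\<And>R x. bounded_linear R \<Longrightarrow> (\<And>x. R (A x) = A (R x)) \<Longrightarrow> R (Y x) = Y (R x)"
proof -
  define Y where "Y x = lim (\<lambda>n. root_iter A n x)" for x
  have Y: "(\<lambda>n. root_iter A n x) \<longlonglongrightarrow> Y x" for x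
    using Cauchy_convergent[OF Cauchy_root_iter[OF lin contr]]
    unfolding Y_def convergent_LIMSEQ_iff by blast
  note lin_iter = linear_root_iter[OF lin contr]
  have norm_iter: "norm (root_iter A n x) \<le> norm x" for n x
    using norm_root_iter_le[OF lin contr, of n x] root_majorant_bounds[of n]
    by (meson mult_left_le_one_le norm_ge_zero order_trans)
  show thesis
  proof (rule that[of Y])
    show "linear Y"
    proof (rule linearI)
      fix x y and r :: real
      have "(\<lambda>n. root_iter A n x + root_iter A n y) \<longlonglongrightarrow> Y (x + y)"
        using Y[of "x + y"] by (simp add: linear_add[OF lin_iter])
      then show "Y (x + y) = Y x + Y y"
        using tendsto_add[OF Y Y] LIMSEQ_unique by blast
      have "(\<lambda>n. r *\<^sub>R root_iter A n x) \<longlonglongrightarrow> Y (r *\<^sub>R x)"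
        using Y[of "r *\<^sub>R x"] by (simp add: linear_scale[OF lin_iter])
      then show "Y (r *\<^sub>R x) = r *\<^sub>R Y x"
        using tendsto_scaleR[OF tendsto_const Y] LIMSEQ_unique by blast
    qed
    show "norm (Y x) \<le> norm x" for x
      by (rule LIMSEQ_le_const2[OF tendsto_norm[OF Y]]) (use norm_iter in auto)
    show "inner (Y x) y = inner x (Y y)" for x y
      using tendsto_inner[OF Y[of x] tendsto_const[of y]]
        tendsto_inner[OF tendsto_const[of x] Y[of y]] LIMSEQ_unique
      by (simp add: root_iter_symmetric[OF sym])
    show "2 *\<^sub>R Y x = A x + Y (Y x)" for x
    proof -
      \<comment> \<open>Pointwise convergence passes through the composition because all iterates
        are contractions: the difference is bounded by the distance from
        \<open>root_iter A n x\<close> to \<open>Y x\<close>.\<close>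
      have "(\<lambda>n. root_iter A n (root_iter A n x) - root_iter A n (Y x)) \<longlonglongrightarrow> 0"
      proof (rule Lim_null_comparison)
        show "\<forall>\<^sub>F n in sequentially. norm (root_iter A n (root_iter A n x) - root_iter A n (Y x))
            \<le> norm (root_iter A n x - Y x)"
          by (simp add: linear_diff[OF lin_iter, symmetric] norm_iter)
        show "(\<lambda>n. norm (root_iter A n x - Y x)) \<longlonglongrightarrow> 0"
          using Y[of x] by (simp add: LIM_zero_iff tendsto_norm_zero)
      qed
      from tendsto_add[OF this Y[of "Y x"]]
      have "(\<lambda>n. root_iter A n (root_iter A n x)) \<longlonglongrightarrow> Y (Y x)" by simp
      then have "(\<lambda>n. 2 *\<^sub>R root_iter A (Suc n) x) \<longlonglongrightarrow> A x + Y (Y x)"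
        by (auto intro!: tendsto_intros)
      moreover have "(\<lambda>n. 2 *\<^sub>R root_iter A (Suc n) x) \<longlonglongrightarrow> 2 *\<^sub>R Y x"
        by (intro tendsto_intros LIMSEQ_Suc Y)
      ultimately show ?thesis using LIMSEQ_unique by blast
    qed
    show "R (Y x) = Y (R x)" if "bounded_linear R" "\<And>x. R (A x) = A (R x)" for R x
    proof -
      have "(\<lambda>n. R (root_iter A n x)) \<longlonglongrightarrow> R (Y x)"
        by (rule bounded_linear.tendsto[OF that(1) Y])
      then show ?thesis
        using Y[of "R x"] LIMSEQ_unique
          root_iter_commute[of R A, OF bounded_linear.linear[OF that(1)] that(2)]
        by simp
    qed
  qed
qed

section \<open>Positive operators: existence and uniqueness of the square root\<close>

lemma positive_operator_symmetric:
  "positive_operator A \<Longrightarrow> inner (A x) y = inner x (A y)"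
  unfolding positive_operator_def by blast

lemma positive_operator_nonneg:
  "positive_operator A \<Longrightarrow> 0 \<le> inner (A x) x"
  unfolding positive_operator_def by blast

text \<open>This is the operator inequality \<open>A\<^sup>2 \<le> c A\<close>. Positivity of
  \<open>A\<close> tested at \<open>c x - A x\<close> gives it without spectral theory, once the
  cubic term \<open>inner (A (A x)) (A x)\<close> is bounded by \<open>c\<close> times the squared
  norm of \<open>A x\<close>.\<close>

lemma positive_operator_norm_sq_le:
  assumes "positive_operator A" and "\<And>x. norm (A x) \<le> c * norm x" and "c > 0"
  shows "(norm (A x))\<^sup>2 \<le> c * inner (A x) x"
proof -
  interpret A: bounded_linear A using assms(1) by (simp add: positive_operator_def)
  have sym: "inner (A (A x)) x = (norm (A x))\<^sup>2"
    using assms(1) by (simp add: positive_operator_def power2_norm_eq_inner)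
  have "inner (A (A x)) (A x) \<le> norm (A (A x)) * norm (A x)"
    using norm_cauchy_schwarz by blast
  also have "\<dots> \<le> c * norm (A x) * norm (A x)"
    by (intro mult_right_mono assms(2)) simp
  finally have *: "inner (A (A x)) (A x) \<le> c * (norm (A x))\<^sup>2"
    by (simp add: power2_eq_square mult_ac)
  have "0 \<le> inner (A (c *\<^sub>R x - A x)) (c *\<^sub>R x - A x)"
    using assms(1) unfolding positive_operator_def by blast
  also have "\<dots> = c\<^sup>2 * inner (A x) x - 2 * c * (norm (A x))\<^sup>2 + inner (A (A x)) (A x)"
    by (simp add: A.diff A.scaleR inner_diff sym inner_commute[of x "A (A x)"]
        dot_square_norm inner_commute[of x "A x"] power2_eq_square[of c] algebra_simps)
  also have "\<dots> \<le> c\<^sup>2 * inner (A x) x - c * (norm (A x))\<^sup>2"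
    using * by simp
  finally have "c * (norm (A x))\<^sup>2 \<le> c * (c * inner (A x) x)"
    by (simp add: power2_eq_square mult_ac)
  then show ?thesis using \<open>c > 0\<close> by simp
qed

lemma positive_operator_bound:
  assumes "positive_operator A"
  obtains c where "c > 0" "\<And>x. norm (A x) \<le> c * norm x"
  using assms bounded_linear.pos_bounded[of A] by (auto simp: positive_operator_def mult.commute)

lemma positive_operator_eq_0:
  assumes "positive_operator A" "inner (A x) x = 0"
  shows "A x = 0"
proof -
  obtain c where "c > 0" "\<And>x. norm (A x) \<le> c * norm x"
    using positive_operator_bound[OF assms(1)] by blast
  then have "(norm (A x))\<^sup>2 \<le> c * inner (A x) x"
    by (intro positive_operator_norm_sq_le assms(1))
  then show ?thesis using assms(2) by simp
qed

text \<open>Rescaling turns \<open>A\<close> into \<open>1 - B\<close> with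
  \<open>B = 1 - A / c\<close> a symmetric contraction; the fixed point \<open>Y\<close> for
  \<open>B\<close> satisfies \<open>(1 - Y)\<^sup>2 = A / c\<close>, and the factor
  \<open>sqrt c\<close> undoes the rescaling. The commutation clause is kept for the uniqueness
  proof.\<close>

lemma positive_sqrt_exists:
  fixes A :: "'h::{real_inner, complete_space} \<Rightarrow> 'h"
  assumes A: "positive_operator A"
  obtains S where "positive_operator S" "S \<circ> S = A"
    "\<forall>R. bounded_linear R \<and> R \<circ> A = A \<circ> R \<longrightarrow> R \<circ> S = S \<circ> R"
proof -
  obtain c where c: "c > 0" "\<And>x. norm (A x) \<le> c * norm x"
    using positive_operator_bound[OF A] by blast
  interpret A: bounded_linear A using A by (simp add: positive_operator_def)
  define B where "B x = x - (1/c) *\<^sub>R A x" for x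
  have "linear B"
    by (rule linearI) (simp_all add: B_def A.add A.scaleR algebra_simps)
  \<comment> \<open>In the expanded square, the bound \<open>A\<^sup>2 \<le> c A\<close> lets half
    of the negative middle term absorb the last one.\<close>
  moreover have "norm (B x) \<le> norm x" for x
  proof (rule power2_le_imp_le)
    have "(norm (B x))\<^sup>2 = (norm x)\<^sup>2 - 2 / c * inner (A x) x + (norm (A x))\<^sup>2 / c\<^sup>2"
      unfolding B_def power2_norm_eq_inner
      by (simp add: inner_diff inner_commute[of "A x" x] power2_eq_square
          diff_divide_distrib)
    also have "\<dots> \<le> (norm x)\<^sup>2 - 2 / c * inner (A x) x + c * inner (A x) x / c\<^sup>2"
      using positive_operator_norm_sq_le[OF A c(2,1), of x]
      by (intro add_left_mono divide_right_mono) auto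
    also have "\<dots> = (norm x)\<^sup>2 - inner (A x) x / c"
      using c(1) by (simp add: power2_eq_square field_simps)
    also have "\<dots> \<le> (norm x)\<^sup>2"
    proof -
      have "0 \<le> inner (A x) x" using A unfolding positive_operator_def by blast
      then show ?thesis using c(1) by simp
    qed
    finally show "(norm (B x))\<^sup>2 \<le> (norm x)\<^sup>2" .
  qed simp
  moreover have "inner (B x) y = inner x (B y)" for x y
    using A by (simp add: B_def inner_diff positive_operator_def)
  ultimately obtain Y where Y: "linear Y" "\<And>x. norm (Y x) \<le> norm x"
    "\<And>x y. inner (Y x) y = inner x (Y y)" "\<And>x. 2 *\<^sub>R Y x = B x + Y (Y x)"
    "\<And>R x. bounded_linear R \<Longrightarrow> (\<And>x. R (B x) = B (R x)) \<Longrightarrow> R (Y x) = Y (R x)"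
    by (rule contraction_root_fixed_point) blast
  define S where "S x = sqrt c *\<^sub>R (x - Y x)" for x
  have "bounded_linear Y"
    by (rule bounded_linear_intro[where K = 1])
       (use Y(1,2) in \<open>auto simp: linear_add linear_scale\<close>)
  then have blS: "bounded_linear S"
    unfolding S_def by (intro bounded_linear_intros)
  \<comment> \<open>Positivity of \<open>1 - Y\<close>, by Cauchy-Schwarz for the contraction
    \<open>Y\<close>.\<close>
  have "inner (Y x) x \<le> inner x x" for x
    using norm_cauchy_schwarz[of "Y x" x] mult_right_mono[OF Y(2)[of x] norm_ge_zero[of x]]
    by (simp add: power2_norm_eq_inner[symmetric] power2_eq_square)
  then have "positive_operator S"
    using blS c(1) Y(3) by (auto simp: positive_operator_def S_def inner_diff)
  moreover have "S (S x) = A x" for x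
  proof -
    have "S (S x) = c *\<^sub>R (x - 2 *\<^sub>R Y x + Y (Y x))"
      using c(1) by (simp add: S_def linear_diff[OF Y(1)] linear_scale[OF Y(1)]
          scaleR_diff_right scaleR_add_right scaleR_2)
    also have "\<dots> = c *\<^sub>R (x - B x)" by (simp add: Y(4))
    also have "\<dots> = A x" using c(1) by (simp add: B_def)
    finally show ?thesis .
  qed
  moreover have "R \<circ> S = S \<circ> R" if R: "bounded_linear R" "R \<circ> A = A \<circ> R" for R
  proof
    fix x
    interpret R: bounded_linear R by fact
    have "R (Y x) = Y (R x)"
      by (rule Y(5)[OF R(1)]) (simp add: B_def R.diff R.scaleR fun_cong[OF R(2), unfolded comp_apply])
    then show "(R \<circ> S) x = (S \<circ> R) x" by (simp add: S_def R.diff R.scaleR)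
  qed
  ultimately show thesis by (intro that[of S]) auto
qed

text \<open>The content is uniqueness, which makes the definite description in
  \<open>op_sqrt\<close> proper. Two positive roots \<open>R\<close> and \<open>S\<close> commute,
  so \<open>R + S\<close> kills \<open>y = R x - S x\<close>; both nonnegative forms then vanish at
  \<open>y\<close>, hence \<open>R y = S y = 0\<close>, and the squared norm of \<open>y\<close> is
  \<open>inner x (R y - S y) = 0\<close>.\<close>

lemma positive_operator_op_sqrt:
  fixes A :: "'h::{real_inner, complete_space} \<Rightarrow> 'h"
  assumes A: "positive_operator A"
  shows "positive_operator (op_sqrt A)"
proof -
  obtain S where S: "positive_operator S" "S \<circ> S = A"
    "\<forall>R. bounded_linear R \<and> R \<circ> A = A \<circ> R \<longrightarrow> R \<circ> S = S \<circ> R"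
    by (rule positive_sqrt_exists[OF A])
  interpret S: bounded_linear S using S(1) by (simp add: positive_operator_def)
  have "R = S" if R: "positive_operator R" "R \<circ> R = A" for R
  proof
    fix x
    interpret R: bounded_linear R using R(1) by (simp add: positive_operator_def)
    have "R \<circ> A = A \<circ> R"
      unfolding R(2)[symmetric] by (rule comp_assoc[symmetric])
    then have "R \<circ> S = S \<circ> R"
      using S(3) R.bounded_linear_axioms by blast
    from fun_cong[OF this] have comm: "R (S x) = S (R x)" for x by simp
    have sq: "R (R x) = S (S x)"
      using fun_cong[OF R(2), of x] fun_cong[OF S(2), of x] by simp
    define y where "y = R x - S x"
    have "R y + S y = 0"
      by (simp add: y_def R.diff S.diff comm sq)
    then have "inner (R y) y + inner (S y) y = 0"
      by (simp add: inner_add_left[symmetric])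
    moreover have "0 \<le> inner (R y) y" "0 \<le> inner (S y) y"
      by (rule positive_operator_nonneg, fact)+
    ultimately have "inner (R y) y = 0" "inner (S y) y = 0"
      by linarith+
    then have "R y = 0" "S y = 0"
      using positive_operator_eq_0[OF R(1), of y] positive_operator_eq_0[OF S(1), of y]
      by blast+
    moreover have "inner y y = inner x (R y - S y)"
    proof -
      have "inner (R x) y = inner x (R y)" "inner (S x) y = inner x (S y)"
        by (rule positive_operator_symmetric, fact)+
      then show ?thesis by (simp add: y_def inner_diff_left inner_diff_right)
    qed
    ultimately show "R x = S x" by (simp add: y_def)
  qed
  then have "op_sqrt A = S"
    unfolding op_sqrt_def using S(1,2) by (blast intro: the_equality)
  then show ?thesis using S(1) by simp
qed

section \<open>Compactness of the set of couplings\<close>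

text \<open>By Tychonoff the cube of all functions into the unit interval is compact. The index type
  may be uncountable, so a cluster point need not be the limit of a subsequence; a proper filter
  finer than \<open>sequentially\<close> takes the place of the subsequence.\<close>

lemma convergent_subfilter:
  fixes m :: "nat \<Rightarrow> 'a \<Rightarrow> real"
  assumes m: "\<And>n E. m n E \<in> {0..1}"
  obtains F f where "F \<le> sequentially" "F \<noteq> bot" "\<And>E. ((\<lambda>n. m n E) \<longlongrightarrow> f E) F"
proof -
  have "compactin (product_topology (\<lambda>_::'a. euclideanreal) UNIV) (Pi\<^sub>E UNIV (\<lambda>_. {0..1}))"
    by (simp add: compactin_PiE)
  then have "compact (Pi\<^sub>E UNIV (\<lambda>_. {0..1}) :: ('a \<Rightarrow> real) set)"
    by (simp add: euclidean_product_topology)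
  moreover have "filtermap m sequentially \<noteq> bot"
    by (simp add: filtermap_bot_iff)
  moreover have "\<forall>\<^sub>F g in filtermap m sequentially. g \<in> Pi\<^sub>E UNIV (\<lambda>_. {0..1})"
    using m by (simp add: eventually_filtermap PiE_UNIV_domain)
  ultimately obtain f where f: "inf (nhds f) (filtermap m sequentially) \<noteq> bot"
    unfolding compact_filter by blast
  \<comment> \<open>\<open>F\<close> adds to \<open>sequentially\<close> the requirement that
    \<open>m n\<close> be close to \<open>f\<close>. It is proper because otherwise some tail of
    \<open>m\<close> would avoid a neighbourhood of the cluster point \<open>f\<close>.\<close>
  define F where "F = inf (filtercomap m (nhds f)) sequentially"
  show thesis
  proof (rule that[of F f])
    show "F \<le> sequentially" by (simp add: F_def)
    show "F \<noteq> bot"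
    proof
      assume "F = bot"
      then have "eventually (\<lambda>_. False) F" by simp
      then obtain U Q where U: "eventually U (nhds f)" and Q: "eventually Q sequentially"
        and disj: "\<And>n. U (m n) \<Longrightarrow> Q n \<Longrightarrow> False"
        unfolding F_def eventually_inf eventually_filtercomap by blast
      have "eventually (\<lambda>g. \<not> U g) (filtermap m sequentially)"
        unfolding eventually_filtermap using Q by eventually_elim (use disj in blast)
      with U have "eventually (\<lambda>_. False) (inf (nhds f) (filtermap m sequentially))"
        unfolding eventually_inf by blast
      with f show False by (simp add: eventually_False)
    qed
    show "((\<lambda>n. m n E) \<longlongrightarrow> f E) F" for E
    proof -
      have "filterlim m (nhds f) F"
        unfolding F_def by (rule filterlim_mono[OF filterlim_filtercomap order_refl inf_le1])
      from continuous_on_tendsto_compose[OF continuous_on_product_coordinates[of E] this]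
      show ?thesis by simp
    qed
  qed
qed

lemma couplingsD:
  assumes "\<pi> \<in> couplings P Q"
  shows "prob_space \<pi>" and "sets \<pi> = sets (P \<Otimes>\<^sub>M Q)" and "distr \<pi> P fst = P"
    and "distr \<pi> Q snd = Q"
  using assms by (auto simp: couplings_def)

lemma couplings_marginal_measure:
  assumes "\<pi> \<in> couplings P Q"
  shows "A \<in> sets P \<Longrightarrow> measure \<pi> (A \<times> space Q) = measure P A"
    and "B \<in> sets Q \<Longrightarrow> measure \<pi> (space P \<times> B) = measure Q B"
proof -
  note c = couplingsD[OF assms]
  have [measurable]: "fst \<in> measurable \<pi> P" "snd \<in> measurable \<pi> Q"
    using c(2) measurable_cong_sets by blast+
  have sp: "space \<pi> = space P \<times> space Q"
    using sets_eq_imp_space_eq[OF c(2)] by (simp add: space_pair_measure)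
  show "measure \<pi> (A \<times> space Q) = measure P A" if "A \<in> sets P"
  proof -
    have "measure (distr \<pi> P fst) A = measure \<pi> (fst -` A \<inter> space \<pi>)"
      using that by (intro measure_distr) auto
    also have "fst -` A \<inter> space \<pi> = A \<times> space Q"
      using sets.sets_into_space[OF that] by (auto simp: sp)
    finally show ?thesis by (simp add: c(3))
  qed
  show "measure \<pi> (space P \<times> B) = measure Q B" if "B \<in> sets Q"
  proof -
    have "measure (distr \<pi> Q snd) B = measure \<pi> (snd -` B \<inter> space \<pi>)"
      using that by (intro measure_distr) auto
    also have "snd -` B \<inter> space \<pi> = space P \<times> B"
      using sets.sets_into_space[OF that] by (auto simp: sp)
    finally show ?thesis by (simp add: c(4))
  qed
qed

section \<open>Measurable rectangles, inner regularity and extension to a coupling\<close>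

lemma semiring_of_measurable_rectangles:
  "semiring_of_sets UNIV {A \<times> B | A B. A \<in> sets (borel :: 'a::topological_space measure)
     \<and> B \<in> sets (borel :: 'b::topological_space measure)}" (is "semiring_of_sets UNIV ?R")
proof (standard, safe)
  show "\<exists>A B. {} = A \<times> B \<and> A \<in> sets borel \<and> B \<in> sets borel"
    by (intro exI[of _ "{}"]) auto
next
  fix A A' :: "'a set" and B B' :: "'b set"
  assume m[measurable]: "A \<in> sets borel" "B \<in> sets borel" "A' \<in> sets borel" "B' \<in> sets borel"
  show "\<exists>C D. A \<times> B \<inter> A' \<times> B' = C \<times> D \<and> C \<in> sets borel \<and> D \<in> sets borel"
    by (intro exI[of _ "A \<inter> A'"] exI[of _ "B \<inter> B'"]) auto
  \<comment> \<open>The removed part splits by the first coordinate: either it leaves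
    \<open>A'\<close>, or it stays in \<open>A'\<close> and the second coordinate leaves
    \<open>B'\<close>.\<close>
  let ?C = "{(A - A') \<times> B, (A \<inter> A') \<times> (B - B')}"
  have "?C \<subseteq> ?R"
    using m by (blast intro: sets.Diff sets.Int)
  moreover have "disjoint ?C" "A \<times> B - A' \<times> B' = \<Union>?C"
    by (auto simp: disjoint_def)
  ultimately show "\<exists>C\<subseteq>?R. finite C \<and> disjoint C \<and> A \<times> B - A' \<times> B' = \<Union>C"
    by (intro exI[of _ ?C]) simp
qed auto

lemma finite_measure_compact_inner_approx:
  fixes P :: "'a::polish_space measure"
  assumes "finite_measure P" "sets P = sets borel" "A \<in> sets borel" "0 < \<delta>"
  obtains K where "compact K" "K \<subseteq> A" "measure P (A - K) < \<delta>"
proof -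
  interpret finite_measure P by fact
  show thesis
  proof (cases "measure P A < \<delta>")
    \<comment> \<open>For a set of mass below \<delta> the empty compact set suffices. In the other
      case \<open>measure P A - \<delta>\<close> is nonnegative, so its embedding into the extended
      reals loses nothing.\<close>
    case True
    then show thesis by (intro that[of "{}"]) auto
  next
    case False
    have "emeasure P A = (SUP K\<in>{K. K \<subseteq> A \<and> compact K}. emeasure P K)"
      by (rule inner_regular) (use assms in auto)
    moreover have "ennreal (measure P A - \<delta>) < emeasure P A"
      using False \<open>0 < \<delta>\<close> by (simp add: emeasure_eq_measure ennreal_less_iff)
    ultimately obtain K where K: "K \<subseteq> A" "compact K" "ennreal (measure P A - \<delta>) < emeasure P K"
      by (auto simp: less_SUP_iff)
    have "K \<in> sets P" using K(2) assms(2) by (simp add: borel_compact)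
    moreover have "measure P A - \<delta> < measure P K"
      using K(3) False by (simp add: emeasure_eq_measure ennreal_less_iff)
    ultimately have "measure P (A - K) < \<delta>"
      using K(1) assms(2,3) by (subst finite_measure_Diff) auto
    with K show thesis by (intro that[of K])
  qed
qed

text \<open>A finitely additive set function with \<open>\<sigma>\<close>-additive marginals is \<open>\<sigma>\<close>-additive on
  the ring of measurable rectangles: inner regularity of the marginals approximates every
  member of the ring from inside by a compact set.\<close>

locale additive_coupling =
  fixes P :: "'a::polish_space measure" and Q :: "'b::polish_space measure"
    and f :: "('a \<times> 'b) set \<Rightarrow> real"
  assumes P: "prob_space P" and sets_P: "sets P = sets borel"
    and Q: "prob_space Q" and sets_Q: "sets Q = sets borel"
    and nonneg: "0 \<le> f E"
    and additive: "E \<in> sets borel \<Longrightarrow> E' \<in> sets borel \<Longrightarrow> E \<inter> E' = {} \<Longrightarrow> f (E \<union> E') = f E + f E'"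
    and fst_marginal: "A \<in> sets borel \<Longrightarrow> f (A \<times> UNIV) = measure P A"
    and snd_marginal: "B \<in> sets borel \<Longrightarrow> f (UNIV \<times> B) = measure Q B"
begin

interpretation P: prob_space P by (rule P)
interpretation Q: prob_space Q by (rule Q)

abbreviation rectangles :: "('a \<times> 'b) set set" where
  "rectangles \<equiv> {A \<times> B | A B. A \<in> sets borel \<and> B \<in> sets borel}"

lemma space_P: "space P = UNIV" and space_Q: "space Q = UNIV"
  using sets_eq_imp_space_eq[OF sets_P] sets_eq_imp_space_eq[OF sets_Q] by auto

lemma rectangle_borel:
  assumes "A \<in> sets borel" "B \<in> sets borel"
  shows "A \<times> B \<in> sets (borel :: ('a \<times> 'b) measure)"
  using assms by (auto simp: borel_prod[symmetric])

lemma f_empty: "f {} = 0"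
  using additive[of "{}" "{}"] by simp

lemma f_mono:
  assumes "E \<in> sets borel" "E' \<in> sets borel" "E \<subseteq> E'"
  shows "f E \<le> f E'"
proof -
  have "f (E \<union> (E' - E)) = f E + f (E' - E)"
    by (rule additive) (use assms in auto)
  moreover have "E \<union> (E' - E) = E'" using assms(3) by auto
  ultimately show ?thesis using nonneg[of "E' - E"] by simp
qed

lemma f_subadditive:
  assumes "E \<in> sets borel" "E' \<in> sets borel"
  shows "f (E \<union> E') \<le> f E + f E'"
proof -
  have "f (E \<union> (E' - E)) = f E + f (E' - E)"
    by (rule additive) (use assms in auto)
  moreover have "f (E' - E) \<le> f E'"
    by (rule f_mono) (use assms in auto)
  ultimately show ?thesis by simp
qed

lemma f_subadditive_UN:
  assumes "finite I" "\<And>i. i \<in> I \<Longrightarrow> E i \<in> sets borel"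
  shows "f (\<Union>i\<in>I. E i) \<le> (\<Sum>i\<in>I. f (E i))"
  using assms
proof (induction I)
  case (insert i I)
  have "f (E i \<union> (\<Union>i\<in>I. E i)) \<le> f (E i) + f (\<Union>i\<in>I. E i)"
    using insert by (intro f_subadditive sets.finite_UN) auto
  with insert show ?case by simp
qed (simp add: f_empty)

text \<open>The part of \<open>A \<times> B\<close> outside \<open>A' \<times> B'\<close> lies in
  the strips over \<open>A - A'\<close> and \<open>B - B'\<close>. The value of \<open>f\<close> on
  strips is a marginal mass, so inner regularity of \<open>P\<close> and \<open>Q\<close> controls
  the error although \<open>f\<close> is only finitely additive.\<close>

lemma compact_inner_approx_rectangle:
  assumes A: "A \<in> sets borel" and B: "B \<in> sets borel" and "0 < \<delta>"
  obtains K where "compact K" "K \<subseteq> A \<times> B" "f (A \<times> B - K) < \<delta>"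
proof -
  have half: "0 < \<delta> / 2" using \<open>0 < \<delta>\<close> by simp
  obtain A' where A': "compact A'" "A' \<subseteq> A" "measure P (A - A') < \<delta> / 2"
    by (rule finite_measure_compact_inner_approx[OF P.finite_measure_axioms sets_P A half])
  obtain B' where B': "compact B'" "B' \<subseteq> B" "measure Q (B - B') < \<delta> / 2"
    by (rule finite_measure_compact_inner_approx[OF Q.finite_measure_axioms sets_Q B half])
  have diff: "A - A' \<in> sets borel" "B - B' \<in> sets borel"
    and A'B': "A' \<times> B' \<in> sets borel"
    using A B borel_compact[OF A'(1)] borel_compact[OF B'(1)] by (simp_all add: rectangle_borel)
  have strips: "(A - A') \<times> (UNIV :: 'b set) \<in> sets borel" "(UNIV :: 'a set) \<times> (B - B') \<in> sets borel"
    using diff by (auto intro!: rectangle_borel)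
  have "f (A \<times> B - A' \<times> B') \<le> f ((A - A') \<times> UNIV \<union> UNIV \<times> (B - B'))"
    by (intro f_mono sets.Un sets.Diff rectangle_borel[OF A B] A'B' strips) blast
  also have "\<dots> \<le> f ((A - A') \<times> UNIV) + f (UNIV \<times> (B - B'))"
    by (intro f_subadditive strips)
  also have "\<dots> = measure P (A - A') + measure Q (B - B')"
    using diff by (simp add: fst_marginal snd_marginal)
  also have "\<dots> < \<delta>" using A'(3) B'(3) by simp
  finally show thesis
    using A' B' by (intro that[of "A' \<times> B'"] compact_Times Sigma_mono)
qed

lemma compact_inner_approx:
  assumes "finite C" "C \<subseteq> rectangles" "0 < \<delta>"
  shows "\<exists>K. compact K \<and> K \<subseteq> \<Union>C \<and> f (\<Union>C - K) < \<delta>"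
  using assms
proof (induction C arbitrary: \<delta>)
  case empty
  then show ?case by (intro exI[of _ "{}"]) (simp add: f_empty)
next
  case (insert R C)
  then obtain A B where R: "R = A \<times> B" "A \<in> sets borel" "B \<in> sets borel" by blast
  have half: "0 < \<delta> / 2" using insert.prems by simp
  obtain K where K: "compact K" "K \<subseteq> A \<times> B" "f (A \<times> B - K) < \<delta> / 2"
    by (rule compact_inner_approx_rectangle[OF R(2,3) half])
  have C_sub: "C \<subseteq> rectangles"
    using insert.prems(1) by (rule insert_subset[THEN iffD1, THEN conjunct2])
  obtain K' where K': "compact K'" "K' \<subseteq> \<Union>C" "f (\<Union>C - K') < \<delta> / 2"
    using insert.IH[OF C_sub half] by blast
  have "C \<subseteq> sets borel"
    using C_sub rectangle_borel by fast
  then have C: "\<Union>C \<in> sets borel"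
    using insert.hyps by (intro sets.finite_Union)
  have AB: "A \<times> B \<in> sets borel"
    using R(2,3) by (rule rectangle_borel)
  have KK: "K \<in> sets borel" "K' \<in> sets borel"
    using K(1) K'(1) by (auto intro: borel_compact)
  have "f (\<Union>(insert R C) - (K \<union> K')) \<le> f ((A \<times> B - K) \<union> (\<Union>C - K'))"
    unfolding R(1) Union_insert by (intro f_mono sets.Un sets.Diff C KK AB) auto
  also have "\<dots> \<le> f (A \<times> B - K) + f (\<Union>C - K')"
    by (intro f_subadditive sets.Diff C KK AB)
  also have "\<dots> < \<delta>" using K(3) K'(3) by simp
  finally show ?case
    using K(1,2) K'(1,2) R(1) by (intro exI[of _ "K \<union> K'"]) (auto intro: compact_Un)
qed

sublocale rect: semiring_of_sets UNIV rectangles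
  by (rule semiring_of_measurable_rectangles)

lemma generated_ring_borel:
  assumes "E \<in> rect.generated_ring"
  shows "E \<in> sets borel"
  using assms
proof (rule rect.generated_ringE)
  fix C assume C: "finite C" "C \<subseteq> rectangles" "E = \<Union>C"
  then have "C \<subseteq> sets borel" using rectangle_borel by fast
  with C show ?thesis by (simp add: sets.finite_Union)
qed

text \<open>Compact sets \<open>K i\<close> inside \<open>E i\<close> have empty total intersection,
  so finitely many of them, with indices up to some \<open>N\<close>, already do. For
  \<open>n \<ge> N\<close> each point of \<open>E n\<close> then misses some \<open>K i\<close> with
  \<open>i \<le> N\<close>, so \<open>E n\<close> is covered by the errors \<open>E i - K i\<close>,
  whose masses sum to less than \<delta>.\<close>

lemma empty_continuous:
  assumes ring: "range E \<subseteq> rect.generated_ring" and dec: "decseq E" and "(\<Inter>i. E i) = {}"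
  shows "(\<lambda>i. f (E i)) \<longlonglongrightarrow> 0"
proof (rule LIMSEQ_I)
  fix \<delta> :: real assume "0 < \<delta>"
  have "\<exists>K. compact K \<and> K \<subseteq> E i \<and> f (E i - K) < \<delta> / 2 ^ Suc i" for i
  proof -
    have "E i \<in> rect.generated_ring" using ring by auto
    then obtain C where C: "finite C" "C \<subseteq> rectangles" "E i = \<Union>C"
      by (rule rect.generated_ringE)
    show ?thesis
      unfolding C(3) using C(1,2) \<open>0 < \<delta>\<close> by (intro compact_inner_approx) auto
  qed
  then obtain K where K: "\<And>i. compact (K i)" "\<And>i. K i \<subseteq> E i"
    "\<And>i. f (E i - K i) < \<delta> / 2 ^ Suc i"
    by metis
  \<comment> \<open>The finite intersection property is applied inside the compact set
    \<open>K 0\<close>, with all \<open>K i\<close> as closed sets.\<close>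
  have "\<exists>I. finite I \<and> K 0 \<inter> (\<Inter>i\<in>I. K i) = {}"
  proof (rule ccontr)
    assume "\<not> ?thesis"
    then have "K 0 \<inter> (\<Inter>i\<in>UNIV. K i) \<noteq> {}"
      by - (rule compact_imp_fip_image[OF K(1) compact_imp_closed[OF K(1)]], blast)
    moreover have "(\<Inter>i\<in>UNIV. K i) \<subseteq> (\<Inter>i. E i)"
      using K(2) by blast
    ultimately show False
      using \<open>(\<Inter>i. E i) = {}\<close> by simp
  qed
  then obtain I where I: "finite I" "K 0 \<inter> (\<Inter>i\<in>I. K i) = {}" by blast
  \<comment> \<open>Inserting 0 accounts for \<open>K 0\<close> and keeps the maximum defined when
    \<open>I\<close> is empty.\<close>
  define N where "N = Max (insert 0 I)"
  have N: "i \<le> N" if "i \<in> insert 0 I" for i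
    unfolding N_def using I(1) that by (intro Max_ge) auto
  have borel: "E i \<in> sets borel" "E i - K i \<in> sets borel" for i
    using ring generated_ring_borel[of "E i"] borel_compact[OF K(1), of i] by auto
  have "f (E n) < \<delta>" if "N \<le> n" for n
  proof -
    have "E n \<subseteq> (\<Union>i\<le>N. E i - K i)"
    proof
      fix x assume x: "x \<in> E n"
      obtain i where i: "i \<in> insert 0 I" "x \<notin> K i" using I(2) by auto
      then have "i \<le> n" using N that by fastforce
      then have "x \<in> E i" using decseqD[OF dec, of i n] x by blast
      with i N show "x \<in> (\<Union>i\<le>N. E i - K i)" by auto
    qed
    then have "f (E n) \<le> f (\<Union>i\<le>N. E i - K i)"
      using borel by (intro f_mono sets.finite_UN) auto
    also have "\<dots> \<le> (\<Sum>i\<le>N. f (E i - K i))"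
      using borel by (intro f_subadditive_UN) auto
    also have "\<dots> \<le> (\<Sum>i\<le>N. \<delta> / 2 ^ Suc i)"
      by (intro sum_mono less_imp_le K(3))
    also have "\<dots> = \<delta> * (1 - 1 / 2 ^ Suc N)"
      by (induction N) (simp_all add: field_simps)
    also have "\<dots> < \<delta>" using \<open>0 < \<delta>\<close> by simp
    finally show ?thesis .
  qed
  then show "\<exists>no. \<forall>n\<ge>no. norm (f (E n) - 0) < \<delta>"
    using nonneg by auto
qed

lemma sigma_sets_generated_ring: "sigma_sets UNIV rect.generated_ring = sets (P \<Otimes>\<^sub>M Q)"
  unfolding rect.sigma_sets_generated_ring_eq
  by (simp add: sets_pair_measure sets_P sets_Q space_P space_Q)

text \<open>Caratheodory's theorem applies through continuity at the empty set. Agreement with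
  \<open>f\<close> is claimed on rectangles only: a finitely additive \<open>f\<close> may fail
  countable additivity on other Borel sets, such as the diagonal and its complement.\<close>

lemma extends:
  obtains \<pi> where "\<pi> \<in> couplings P Q"
    "\<And>A B. A \<in> sets borel \<Longrightarrow> B \<in> sets borel \<Longrightarrow> measure \<pi> (A \<times> B) = f (A \<times> B)"
proof -
  interpret ring: ring_of_sets UNIV rect.generated_ring
    by (rule rect.generating_ring)
  have "\<exists>\<mu>. (\<forall>E\<in>rect.generated_ring. \<mu> E = ennreal (f E)) \<and>
      measure_space UNIV (sigma_sets UNIV rect.generated_ring) \<mu>"
  proof (rule ring.caratheodory_empty_continuous)
    show "positive rect.generated_ring (\<lambda>E. ennreal (f E))"
      by (simp add: positive_def f_empty)
    show "additive rect.generated_ring (\<lambda>E. ennreal (f E))"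
      by (auto simp: Measure_Space.additive_def additive generated_ring_borel nonneg ennreal_plus)
    show "(\<lambda>i. ennreal (f (E i))) \<longlonglongrightarrow> 0"
      if "range E \<subseteq> rect.generated_ring" "decseq E" "(\<Inter>i. E i) = {}" for E
      using tendsto_ennrealI[OF empty_continuous[OF that]] by simp
  qed simp
  then obtain \<mu> where \<mu>: "\<And>E. E \<in> rect.generated_ring \<Longrightarrow> \<mu> E = ennreal (f E)"
    and ms: "measure_space UNIV (sigma_sets UNIV rect.generated_ring) \<mu>"
    by blast
  define \<pi> where "\<pi> = measure_of UNIV rect.generated_ring \<mu>"
  have sub: "rect.generated_ring \<subseteq> Pow UNIV" by simp
  have sets_\<pi>: "sets \<pi> = sets (P \<Otimes>\<^sub>M Q)"
    unfolding \<pi>_def sets_measure_of[OF sub] by (rule sigma_sets_generated_ring)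
  have space_\<pi>: "space \<pi> = UNIV"
    unfolding \<pi>_def by (rule space_measure_of[OF sub])
  have rectangle: "emeasure \<pi> (A \<times> B) = ennreal (f (A \<times> B))"
    if "A \<in> sets borel" "B \<in> sets borel" for A B
  proof -
    have ring: "A \<times> B \<in> rect.generated_ring"
      using that by (intro rect.generated_ringI_Basic) auto
    have "emeasure \<pi> (A \<times> B) = \<mu> (A \<times> B)"
      by (rule emeasure_measure_of[OF \<pi>_def sub])
         (use ms ring in \<open>auto simp: measure_space_def \<pi>_def sets_measure_of[OF sub]\<close>)
    with \<mu>[OF ring] show ?thesis by simp
  qed
  have [measurable]: "fst \<in> measurable \<pi> P" "snd \<in> measurable \<pi> Q"
    using sets_\<pi> measurable_cong_sets by blast+
  show thesis
  proof (rule that[of \<pi>])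
    show "measure \<pi> (A \<times> B) = f (A \<times> B)" if "A \<in> sets borel" "B \<in> sets borel" for A B
      using rectangle[OF that] nonneg by (simp add: measure_def)
    have "emeasure \<pi> (space \<pi>) = 1"
      using rectangle[of UNIV UNIV] fst_marginal[of UNIV] P.prob_space by (simp add: space_\<pi> space_P)
    moreover have "distr \<pi> P fst = P"
    proof (rule measure_eqI)
      fix A assume "A \<in> sets (distr \<pi> P fst)"
      then have A: "A \<in> sets P" "A \<in> sets borel" by (auto simp: sets_P)
      have "emeasure (distr \<pi> P fst) A = emeasure \<pi> (A \<times> UNIV)"
        using A by (simp add: emeasure_distr space_\<pi> vimage_fst)
      then show "emeasure (distr \<pi> P fst) A = emeasure P A"
        using A by (simp add: rectangle fst_marginal P.emeasure_eq_measure)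
    qed simp
    moreover have "distr \<pi> Q snd = Q"
    proof (rule measure_eqI)
      fix B assume "B \<in> sets (distr \<pi> Q snd)"
      then have B: "B \<in> sets Q" "B \<in> sets borel" by (auto simp: sets_Q)
      have "emeasure (distr \<pi> Q snd) B = emeasure \<pi> (UNIV \<times> B)"
        using B by (simp add: emeasure_distr space_\<pi> vimage_snd)
      then show "emeasure (distr \<pi> Q snd) B = emeasure Q B"
        using B by (simp add: rectangle snd_marginal Q.emeasure_eq_measure)
    qed simp
    ultimately show "\<pi> \<in> couplings P Q"
      using sets_\<pi> by (auto simp: couplings_def intro: prob_spaceI)
  qed
qed

end

section \<open>Limits of sequences of couplings\<close>

text \<open>A cluster point of the set functions \<open>measure (\<pi> n)\<close> inherits
  nonnegativity, finite additivity and both marginals, since these are closed conditions on finitely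
  many values. It therefore extends from the rectangles to a coupling.\<close>

lemma couplings_limit:
  fixes P :: "'a::polish_space measure" and Q :: "'b::polish_space measure"
  assumes P: "prob_space P" "sets P = sets borel" and Q: "prob_space Q" "sets Q = sets borel"
    and \<pi>: "\<And>n. \<pi> n \<in> couplings P Q"
  obtains F \<pi>' where "F \<le> sequentially" "F \<noteq> bot" "\<pi>' \<in> couplings P Q"
    "\<And>A B. A \<in> sets borel \<Longrightarrow> B \<in> sets borel \<Longrightarrow>
      ((\<lambda>n::nat. measure (\<pi> n) (A \<times> B)) \<longlongrightarrow> measure \<pi>' (A \<times> B)) F"
proof -
  have space: "space P = UNIV" "space Q = UNIV"
    using P(2) Q(2) by (auto dest: sets_eq_imp_space_eq)
  have prob: "prob_space (\<pi> n)" and sets: "sets (\<pi> n) = sets borel" for n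
    using couplingsD(1,2)[OF \<pi>[of n]] P(2) Q(2) by (auto simp: borel_prod[symmetric] cong: sets_pair_measure_cong)
  have "measure (\<pi> n) E \<in> {0..1}" for n E
    using prob_space.prob_le_1[OF prob] by simp
  from convergent_subfilter[of "\<lambda>n. measure (\<pi> n)", OF this]
  obtain F f where F: "F \<le> sequentially" "F \<noteq> bot"
    and f: "\<And>E. ((\<lambda>n. measure (\<pi> n) E) \<longlongrightarrow> f E) F"
    by metis
  have limit_eq: "f E = c" if "\<And>n. measure (\<pi> n) E = c" for E c
    using tendsto_unique[OF F(2) f[of E], of c] that by simp
  interpret additive_coupling P Q f
  proof (rule additive_coupling.intro[OF P Q])
    show "0 \<le> f E" for E
      using tendsto_lowerbound[OF f _ F(2)] by simp
    show "f (E \<union> E') = f E + f E'"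
      if "E \<in> sets borel" "E' \<in> sets borel" "E \<inter> E' = {}" for E E'
    proof -
      have "measure (\<pi> n) (E \<union> E') = measure (\<pi> n) E + measure (\<pi> n) E'" for n
        using that prob[of n] unfolding sets[of n, symmetric]
        by (intro finite_measure.finite_measure_Union prob_space.finite_measure)
      then have "((\<lambda>n. measure (\<pi> n) (E \<union> E')) \<longlongrightarrow> f E + f E') F"
        by (simp add: tendsto_add f)
      with f[of "E \<union> E'"] show ?thesis using tendsto_unique[OF F(2)] by blast
    qed
    show "f (A \<times> UNIV) = measure P A" if "A \<in> sets borel" for A
      using couplings_marginal_measure(1)[OF \<pi>] that by (intro limit_eq) (simp add: space P(2))
    show "f (UNIV \<times> B) = measure Q B" if "B \<in> sets borel" for B
      using couplings_marginal_measure(2)[OF \<pi>] that by (intro limit_eq) (simp add: space Q(2))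
  qed
  obtain \<pi>' where \<pi>': "\<pi>' \<in> couplings P Q"
    "\<And>A B. A \<in> sets borel \<Longrightarrow> B \<in> sets borel \<Longrightarrow> measure \<pi>' (A \<times> B) = f (A \<times> B)"
    using extends by metis
  show thesis
  proof (rule that[OF F \<pi>'(1)])
    show "((\<lambda>n. measure (\<pi> n) (A \<times> B)) \<longlongrightarrow> measure \<pi>' (A \<times> B)) F"
      if "A \<in> sets borel" "B \<in> sets borel" for A B
      unfolding \<pi>'(2)[OF that] by (rule f)
  qed
qed

section \<open>Minimizing the expected inner product\<close>

lemma couplings_measurable:
  assumes "\<pi> \<in> couplings P Q"
  shows "fst \<in> measurable \<pi> P" "snd \<in> measurable \<pi> Q"
  using couplingsD(2)[OF assms] measurable_cong_sets by blast+

lemma couplings_marginal_integral: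
  fixes g :: "'a \<Rightarrow> real" and h :: "'b \<Rightarrow> real"
  assumes \<pi>: "\<pi> \<in> couplings P Q"
  shows "integrable P g \<Longrightarrow> integrable \<pi> (\<lambda>z. g (fst z))"
    and "g \<in> borel_measurable P \<Longrightarrow> (\<integral>z. g (fst z) \<partial>\<pi>) = (\<integral>x. g x \<partial>P)"
    and "integrable Q h \<Longrightarrow> integrable \<pi> (\<lambda>z. h (snd z))"
    and "h \<in> borel_measurable Q \<Longrightarrow> (\<integral>z. h (snd z) \<partial>\<pi>) = (\<integral>y. h y \<partial>Q)"
proof -
  note meas = couplings_measurable[OF \<pi>] and marg = couplingsD(3,4)[OF \<pi>]
  show "integrable P g \<Longrightarrow> integrable \<pi> (\<lambda>z. g (fst z))"
    using integrable_distr[OF meas(1), of g] by (simp add: marg)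
  show "g \<in> borel_measurable P \<Longrightarrow> (\<integral>z. g (fst z) \<partial>\<pi>) = (\<integral>x. g x \<partial>P)"
    using integral_distr[OF meas(1), of g] by (simp add: marg)
  show "integrable Q h \<Longrightarrow> integrable \<pi> (\<lambda>z. h (snd z))"
    using integrable_distr[OF meas(2), of h] by (simp add: marg)
  show "h \<in> borel_measurable Q \<Longrightarrow> (\<integral>z. h (snd z) \<partial>\<pi>) = (\<integral>y. h y \<partial>Q)"
    using integral_distr[OF meas(2), of h] by (simp add: marg)
qed

text \<open>Young's inequality. The free weight \<eta> lets a small factor offset a bounded one,
  which replaces the Cauchy-Schwarz inequality for integrals.\<close>

lemma abs_inner_le_weighted:
  fixes a b :: "'h::real_inner"
  assumes "0 < \<eta>"
  shows "\<bar>inner a b\<bar> \<le> (norm a)\<^sup>2 / (2 * \<eta>) + \<eta> / 2 * (norm b)\<^sup>2"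
proof -
  have "0 \<le> (norm a - \<eta> * norm b)\<^sup>2 / (2 * \<eta>)"
    using assms by simp
  also have "\<dots> = (norm a)\<^sup>2 / (2 * \<eta>) + \<eta> / 2 * (norm b)\<^sup>2 - norm a * norm b"
    using assms by (simp add: power2_eq_square field_simps)
  finally show ?thesis using Cauchy_Schwarz_ineq2[of a b] by linarith
qed

text \<open>Young's inequality separates the two coordinates, so the bound sees only the marginals
  and is the same for every coupling.\<close>

lemma coupling_inner_integrable:
  fixes \<phi> :: "'a \<Rightarrow> 'h::{real_inner, second_countable_topology}" and \<psi> :: "'b \<Rightarrow> 'h"
  assumes \<pi>: "\<pi> \<in> couplings P Q"
    and \<phi>: "\<phi> \<in> borel_measurable P" "integrable P (\<lambda>x. (norm (\<phi> x))\<^sup>2)"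
    and \<psi>: "\<psi> \<in> borel_measurable Q" "integrable Q (\<lambda>y. (norm (\<psi> y))\<^sup>2)"
  shows "integrable \<pi> (\<lambda>z. inner (\<phi> (fst z)) (\<psi> (snd z)))"
    and "0 < \<eta> \<Longrightarrow> \<bar>\<integral>z. inner (\<phi> (fst z)) (\<psi> (snd z)) \<partial>\<pi>\<bar>
      \<le> (\<integral>x. (norm (\<phi> x))\<^sup>2 \<partial>P) / (2 * \<eta>) + \<eta> / 2 * (\<integral>y. (norm (\<psi> y))\<^sup>2 \<partial>Q)"
proof -
  note [measurable] = couplings_measurable[OF \<pi>] \<phi>(1) \<psi>(1)
  note int = couplings_marginal_integral(1)[OF \<pi> \<phi>(2)] couplings_marginal_integral(3)[OF \<pi> \<psi>(2)]
  let ?b = "\<lambda>\<eta> z. (norm (\<phi> (fst z)))\<^sup>2 / (2 * \<eta>) + \<eta> / 2 * (norm (\<psi> (snd z)))\<^sup>2"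
  have b: "integrable \<pi> (?b \<eta>)" for \<eta>
    using int by simp
  have bound: "\<bar>inner (\<phi> (fst z)) (\<psi> (snd z))\<bar> \<le> ?b \<eta> z" if "0 < \<eta>" for z \<eta>
    by (rule abs_inner_le_weighted[OF that])
  show *: "integrable \<pi> (\<lambda>z. inner (\<phi> (fst z)) (\<psi> (snd z)))"
    by (rule Bochner_Integration.integrable_bound[OF b[of 1]])
       (use bound[of 1] in \<open>auto intro!: AE_I2\<close>)
  show "\<bar>\<integral>z. inner (\<phi> (fst z)) (\<psi> (snd z)) \<partial>\<pi>\<bar>
      \<le> (\<integral>x. (norm (\<phi> x))\<^sup>2 \<partial>P) / (2 * \<eta>) + \<eta> / 2 * (\<integral>y. (norm (\<psi> y))\<^sup>2 \<partial>Q)" if "0 < \<eta>"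
  proof -
    have "\<bar>\<integral>z. inner (\<phi> (fst z)) (\<psi> (snd z)) \<partial>\<pi>\<bar> \<le> (\<integral>z. \<bar>inner (\<phi> (fst z)) (\<psi> (snd z))\<bar> \<partial>\<pi>)"
      by (rule integral_abs_bound)
    also have "\<dots> \<le> (\<integral>z. ?b \<eta> z \<partial>\<pi>)"
      by (rule integral_mono[OF integrable_abs[OF *] b bound[OF that]])
    also have "\<dots> = (\<integral>x. (norm (\<phi> x))\<^sup>2 \<partial>P) / (2 * \<eta>) + \<eta> / 2 * (\<integral>y. (norm (\<psi> y))\<^sup>2 \<partial>Q)"
      using int couplings_marginal_integral(2)[OF \<pi>, of "\<lambda>x. (norm (\<phi> x))\<^sup>2"]
        couplings_marginal_integral(4)[OF \<pi>, of "\<lambda>x. (norm (\<psi> x))\<^sup>2"]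
      by simp
    finally show ?thesis .
  qed
qed

section \<open>Approximation by simple functions, uniformly over couplings\<close>

text \<open>Dominated convergence along simple functions bounded by
  \<open>2 * norm (\<phi> x)\<close>; hence the factor 4, and the dominating constant 9 as the
  square of 1 + 2. The bound on the second moment of \<open>s\<close> does not involve \<delta>, so
  \<delta> may be chosen in terms of it.\<close>

lemma simple_function_L2_approx:
  fixes \<phi> :: "'a \<Rightarrow> 'h::{real_inner, second_countable_topology}"
  assumes P: "prob_space P" and \<phi>: "\<phi> \<in> borel_measurable P" "integrable P (\<lambda>x. (norm (\<phi> x))\<^sup>2)"
    and "0 < \<delta>"
  obtains s where "simple_function P s" "integrable P (\<lambda>x. (norm (s x))\<^sup>2)"
    "(\<integral>x. (norm (s x))\<^sup>2 \<partial>P) \<le> 4 * (\<integral>x. (norm (\<phi> x))\<^sup>2 \<partial>P)"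
    "integrable P (\<lambda>x. (norm (\<phi> x - s x))\<^sup>2)"
    "(\<integral>x. (norm (\<phi> x - s x))\<^sup>2 \<partial>P) < \<delta>"
proof -
  note [measurable] = \<phi>(1)
  obtain s where simple: "\<And>i. simple_function P (s i)"
    and lim: "\<And>x. x \<in> space P \<Longrightarrow> (\<lambda>i. s i x) \<longlonglongrightarrow> \<phi> x"
    and bound: "\<And>i x. x \<in> space P \<Longrightarrow> norm (s i x) \<le> 2 * norm (\<phi> x)"
    using borel_measurable_implies_sequence_metric[OF \<phi>(1), of 0] by simp metis
  have [measurable]: "s i \<in> borel_measurable P" for i
    by (rule borel_measurable_simple_function[OF simple])
  have sq: "(norm (s i x))\<^sup>2 \<le> 4 * (norm (\<phi> x))\<^sup>2" if "x \<in> space P" for i x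
    using power_mono[OF bound[OF that, of i], of 2] by (simp add: power_mult_distrib)
  have diff: "(norm (\<phi> x - s i x))\<^sup>2 \<le> 9 * (norm (\<phi> x))\<^sup>2" if "x \<in> space P" for i x
  proof -
    have "norm (\<phi> x - s i x) \<le> 3 * norm (\<phi> x)"
      using bound[OF that, of i] norm_triangle_ineq4[of "\<phi> x" "s i x"] by linarith
    from power_mono[OF this, of 2] show ?thesis by (simp add: power_mult_distrib)
  qed
  have int_s: "integrable P (\<lambda>x. (norm (s i x))\<^sup>2)" for i
    by (rule Bochner_Integration.integrable_bound[where f = "\<lambda>x. 4 * (norm (\<phi> x))\<^sup>2"])
       (use \<phi>(2) sq in \<open>auto intro!: AE_I2\<close>)
  have int_diff: "integrable P (\<lambda>x. (norm (\<phi> x - s i x))\<^sup>2)" for i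
    by (rule Bochner_Integration.integrable_bound[where f = "\<lambda>x. 9 * (norm (\<phi> x))\<^sup>2"])
       (use \<phi>(2) diff in \<open>auto intro!: AE_I2\<close>)
  have "(\<lambda>i. \<integral>x. (norm (\<phi> x - s i x))\<^sup>2 \<partial>P) \<longlonglongrightarrow> (\<integral>x. 0 \<partial>P)"
  proof (rule integral_dominated_convergence[where w = "\<lambda>x. 9 * (norm (\<phi> x))\<^sup>2"])
    show "AE x in P. (\<lambda>i. (norm (\<phi> x - s i x))\<^sup>2) \<longlonglongrightarrow> 0"
    proof (rule AE_I2)
      fix x assume "x \<in> space P"
      from tendsto_power[OF tendsto_norm[OF tendsto_diff[OF tendsto_const lim[OF this], of "\<phi> x"]], of 2]
      show "(\<lambda>i. (norm (\<phi> x - s i x))\<^sup>2) \<longlonglongrightarrow> 0" by simp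
    qed
  qed (use \<phi>(2) diff in \<open>auto intro!: AE_I2\<close>)
  then have "\<forall>\<^sub>F i in sequentially. (\<integral>x. (norm (\<phi> x - s i x))\<^sup>2 \<partial>P) < \<delta>"
    using \<open>0 < \<delta>\<close> by (intro order_tendstoD(2)) auto
  then obtain i where i: "(\<integral>x. (norm (\<phi> x - s i x))\<^sup>2 \<partial>P) < \<delta>"
    by (auto simp: eventually_sequentially)
  have "(\<integral>x. (norm (s i x))\<^sup>2 \<partial>P) \<le> (\<integral>x. 4 * (norm (\<phi> x))\<^sup>2 \<partial>P)"
    by (rule integral_mono[OF int_s]) (use \<phi>(2) sq in auto)
  with i show thesis
    by (intro that[of "s i"] simple int_s int_diff) auto
qed

text \<open>Joint level sets of a function of the first and a function of the second coordinate are
  rectangles. Thus the integral depends on the coupling through finitely many rectangle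
  masses.\<close>

lemma integral_inner_simple_functions:
  fixes s :: "'a \<Rightarrow> 'h::{real_inner, second_countable_topology}" and r :: "'b \<Rightarrow> 'h"
  assumes \<pi>: "\<pi> \<in> couplings P Q" and s: "simple_function P s" and r: "simple_function Q r"
  shows "(\<integral>z. inner (s (fst z)) (r (snd z)) \<partial>\<pi>) =
    (\<Sum>a\<in>s ` space P. \<Sum>b\<in>r ` space Q.
       inner a b * measure \<pi> ((s -` {a} \<inter> space P) \<times> (r -` {b} \<inter> space Q)))"
proof -
  interpret prob_space \<pi> using couplingsD(1)[OF \<pi>] .
  have sp: "space \<pi> = space P \<times> space Q"
    using sets_eq_imp_space_eq[OF couplingsD(2)[OF \<pi>]] by (simp add: space_pair_measure)
  let ?R = "\<lambda>a b. (s -` {a} \<inter> space P) \<times> (r -` {b} \<inter> space Q)"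
  have sets: "?R a b \<in> sets \<pi>" for a b
    using simple_functionD(2)[OF s] simple_functionD(2)[OF r]
    by (simp add: couplingsD(2)[OF \<pi>])
  have int: "integrable \<pi> (\<lambda>z. inner a b * indicator (?R a b) z)" for a b
    using sets by (intro integrable_mult_right integrable_real_indicator) (auto simp: emeasure_eq_measure)
  have fin: "finite (s ` space P)" "finite (r ` space Q)"
    using s r by (auto simp: simple_function_def)
  have "(\<integral>z. inner (s (fst z)) (r (snd z)) \<partial>\<pi>) =
    (\<integral>z. (\<Sum>a\<in>s ` space P. \<Sum>b\<in>r ` space Q. inner a b * indicator (?R a b) z) \<partial>\<pi>)"
  proof (rule Bochner_Integration.integral_cong[OF refl])
    fix z assume z: "z \<in> space \<pi>"
    then have z': "fst z \<in> space P" "snd z \<in> space Q" by (auto simp: sp)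
    \<comment> \<open>The point \<open>z\<close> lies in exactly one of the rectangles, so the
      double sum collapses to a single term.\<close>
    have "inner a b * indicator (?R a b) z
        = (if b = r (snd z) then if a = s (fst z) then inner a b else 0 else 0)" for a b
      using z' by (cases z) (simp add: indicator_def)
    then have "(\<Sum>a\<in>s ` space P. \<Sum>b\<in>r ` space Q. inner a b * indicator (?R a b) z)
      = (\<Sum>a\<in>s ` space P. if a = s (fst z) then inner a (r (snd z)) else 0)"
      using fin(2) z'(2) by simp
    also have "\<dots> = inner (s (fst z)) (r (snd z))"
      using fin(1) z'(1) by simp
    finally show "inner (s (fst z)) (r (snd z))
      = (\<Sum>a\<in>s ` space P. \<Sum>b\<in>r ` space Q. inner a b * indicator (?R a b) z)" by simp
  qed
  also have "\<dots> = (\<Sum>a\<in>s ` space P. \<Sum>b\<in>r ` space Q. inner a b * measure \<pi> (?R a b))"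
    using int by (simp add: Bochner_Integration.integral_sum Bochner_Integration.integrable_sum sets)
  finally show ?thesis .
qed

text \<open>The functions are replaced one at a time, first \<phi> by \<open>s\<close> and then
  \<psi> by \<open>r\<close>; each change is bounded through the marginals alone.\<close>

lemma coupling_inner_perturb:
  fixes \<phi> s :: "'a \<Rightarrow> 'h::{real_inner, second_countable_topology}" and \<psi> r :: "'b \<Rightarrow> 'h"
  assumes \<pi>: "\<pi> \<in> couplings P Q"
    and \<phi>: "\<phi> \<in> borel_measurable P" "integrable P (\<lambda>x. (norm (\<phi> x))\<^sup>2)"
    and \<psi>: "\<psi> \<in> borel_measurable Q" "integrable Q (\<lambda>y. (norm (\<psi> y))\<^sup>2)"
    and s: "s \<in> borel_measurable P" "integrable P (\<lambda>x. (norm (s x))\<^sup>2)"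
      "integrable P (\<lambda>x. (norm (\<phi> x - s x))\<^sup>2)"
    and r: "r \<in> borel_measurable Q" "integrable Q (\<lambda>y. (norm (r y))\<^sup>2)"
      "integrable Q (\<lambda>y. (norm (\<psi> y - r y))\<^sup>2)"
    and "0 < \<eta>"
  shows "\<bar>(\<integral>z. inner (\<phi> (fst z)) (\<psi> (snd z)) \<partial>\<pi>) - (\<integral>z. inner (s (fst z)) (r (snd z)) \<partial>\<pi>)\<bar>
    \<le> ((\<integral>x. (norm (\<phi> x - s x))\<^sup>2 \<partial>P) + (\<integral>y. (norm (\<psi> y - r y))\<^sup>2 \<partial>Q)) / (2 * \<eta>)
      + \<eta> / 2 * ((\<integral>x. (norm (s x))\<^sup>2 \<partial>P) + (\<integral>y. (norm (\<psi> y))\<^sup>2 \<partial>Q))"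
proof -
  note [measurable] = \<phi>(1) \<psi>(1) s(1) r(1)
  have \<phi>s: "(\<lambda>x. \<phi> x - s x) \<in> borel_measurable P" and \<psi>r: "(\<lambda>y. \<psi> y - r y) \<in> borel_measurable Q"
    by measurable
  note 1 = coupling_inner_integrable[OF \<pi> \<phi>s s(3) \<psi>]
    and 2 = coupling_inner_integrable[OF \<pi> s(1,2) \<psi>r r(3)]
  have "(\<integral>z. inner (\<phi> (fst z)) (\<psi> (snd z)) \<partial>\<pi>) - (\<integral>z. inner (s (fst z)) (r (snd z)) \<partial>\<pi>)
      = (\<integral>z. inner (\<phi> (fst z) - s (fst z)) (\<psi> (snd z)) + inner (s (fst z)) (\<psi> (snd z) - r (snd z)) \<partial>\<pi>)"
    using coupling_inner_integrable(1)[OF \<pi> \<phi> \<psi>] coupling_inner_integrable(1)[OF \<pi> s(1,2) r(1,2)]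
    by (subst Bochner_Integration.integral_diff[symmetric]) (auto simp: inner_diff)
  also have "\<dots> = (\<integral>z. inner (\<phi> (fst z) - s (fst z)) (\<psi> (snd z)) \<partial>\<pi>)
      + (\<integral>z. inner (s (fst z)) (\<psi> (snd z) - r (snd z)) \<partial>\<pi>)"
    by (rule Bochner_Integration.integral_add[OF 1(1) 2(1)])
  finally show ?thesis
    \<comment> \<open>In the second term the small factor stands on the right, so the reciprocal
      weight is used there; both errors end up divided by \<open>2 * \<eta>\<close>.\<close>
    using 1(2)[OF \<open>0 < \<eta>\<close>] 2(2)[of "1 / \<eta>"] \<open>0 < \<eta>\<close>
    by (simp add: add_divide_distrib distrib_left mult_ac)
qed

text \<open>Approximation by simple functions in \<open>L\<^sup>2\<close> of the marginals is uniform over all couplings,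
  which reduces the convergence to that of the masses of rectangles.\<close>

lemma coupling_inner_tendsto:
  fixes \<phi> :: "'a::topological_space \<Rightarrow> 'h::{real_inner, second_countable_topology}"
    and \<psi> :: "'b::topological_space \<Rightarrow> 'h"
  assumes P: "prob_space P" "sets P = sets borel" and Q: "prob_space Q" "sets Q = sets borel"
    and \<pi>: "\<And>n. \<pi> n \<in> couplings P Q" and \<pi>': "\<pi>' \<in> couplings P Q"
    and rect: "\<And>A B. A \<in> sets borel \<Longrightarrow> B \<in> sets borel \<Longrightarrow>
      ((\<lambda>n. measure (\<pi> n) (A \<times> B)) \<longlongrightarrow> measure \<pi>' (A \<times> B)) F"
    and \<phi>: "\<phi> \<in> borel_measurable P" "integrable P (\<lambda>x. (norm (\<phi> x))\<^sup>2)"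
    and \<psi>: "\<psi> \<in> borel_measurable Q" "integrable Q (\<lambda>y. (norm (\<psi> y))\<^sup>2)"
  shows "((\<lambda>n. \<integral>z. inner (\<phi> (fst z)) (\<psi> (snd z)) \<partial>\<pi> n)
    \<longlongrightarrow> (\<integral>z. inner (\<phi> (fst z)) (\<psi> (snd z)) \<partial>\<pi>')) F"
proof (rule tendstoI)
  fix e :: real assume "0 < e"
  let ?V = "\<integral>x. (norm (\<phi> x))\<^sup>2 \<partial>P" and ?W = "\<integral>y. (norm (\<psi> y))\<^sup>2 \<partial>Q"
  \<comment> \<open>\<open>c\<close> bounds the second moments of \<open>s\<close> and \<psi>
    together, with 1 added for positivity. The choice of \<eta> makes \<open>\<eta> / 2 * c\<close>
    equal to \<open>e / 8\<close>, and the choice of \<delta> makes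
    \<open>(\<delta> + \<delta>) / (2 * \<eta>)\<close> equal to \<open>e / 8\<close>.\<close>
  define c where "c = 4 * ?V + ?W + 1"
  have c: "0 < c" unfolding c_def by (intro add_nonneg_pos add_nonneg_nonneg) auto
  define \<eta> where "\<eta> = e / (4 * c)"
  have \<eta>: "0 < \<eta>" using \<open>0 < e\<close> c by (simp add: \<eta>_def)
  define \<delta> where "\<delta> = \<eta> * e / 8"
  have \<delta>: "0 < \<delta>" using \<open>0 < e\<close> \<eta> by (simp add: \<delta>_def)
  obtain s where s: "simple_function P s" "integrable P (\<lambda>x. (norm (s x))\<^sup>2)"
    "(\<integral>x. (norm (s x))\<^sup>2 \<partial>P) \<le> 4 * ?V"
    "integrable P (\<lambda>x. (norm (\<phi> x - s x))\<^sup>2)" "(\<integral>x. (norm (\<phi> x - s x))\<^sup>2 \<partial>P) < \<delta>"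
    by (rule simple_function_L2_approx[OF P(1) \<phi> \<delta>])
  obtain r where r: "simple_function Q r" "integrable Q (\<lambda>x. (norm (r x))\<^sup>2)"
    "(\<integral>x. (norm (r x))\<^sup>2 \<partial>Q) \<le> 4 * ?W"
    "integrable Q (\<lambda>x. (norm (\<psi> x - r x))\<^sup>2)" "(\<integral>x. (norm (\<psi> x - r x))\<^sup>2 \<partial>Q) < \<delta>"
    by (rule simple_function_L2_approx[OF Q(1) \<psi> \<delta>])
  let ?I = "\<lambda>\<gamma>. \<integral>z. inner (\<phi> (fst z)) (\<psi> (snd z)) \<partial>\<gamma>"
    and ?J = "\<lambda>\<gamma>. \<integral>z. inner (s (fst z)) (r (snd z)) \<partial>\<gamma>"
  have close: "\<bar>?I \<gamma> - ?J \<gamma>\<bar> \<le> e / 4" if "\<gamma> \<in> couplings P Q" for \<gamma>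
  proof -
    have "\<bar>?I \<gamma> - ?J \<gamma>\<bar>
      \<le> ((\<integral>x. (norm (\<phi> x - s x))\<^sup>2 \<partial>P) + (\<integral>y. (norm (\<psi> y - r y))\<^sup>2 \<partial>Q)) / (2 * \<eta>)
        + \<eta> / 2 * ((\<integral>x. (norm (s x))\<^sup>2 \<partial>P) + ?W)"
      by (intro coupling_inner_perturb that \<phi> \<psi> s r \<eta> borel_measurable_simple_function)
    also have "\<dots> \<le> (\<delta> + \<delta>) / (2 * \<eta>) + \<eta> / 2 * c"
      using s(3,5) r(5) \<eta> by (intro add_mono divide_right_mono mult_left_mono) (auto simp: c_def)
    also have "\<dots> = e / 4"
      using \<eta> c unfolding \<delta>_def by (simp add: field_simps) (simp add: \<eta>_def field_simps)
    finally show ?thesis .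
  qed
  have "((\<lambda>n. ?J (\<pi> n)) \<longlongrightarrow> ?J \<pi>') F"
    unfolding integral_inner_simple_functions[OF \<pi> s(1) r(1)]
      integral_inner_simple_functions[OF \<pi>' s(1) r(1)]
    using simple_functionD(2)[OF s(1)] simple_functionD(2)[OF r(1)]
    by (intro tendsto_sum tendsto_mult tendsto_const rect) (auto simp: P(2) Q(2))
  then have "\<forall>\<^sub>F n in F. dist (?J (\<pi> n)) (?J \<pi>') < e / 4"
    using \<open>0 < e\<close> by (intro tendstoD) auto
  \<comment> \<open>Three errors of at most \<open>e / 4\<close> each: two approximations and the
    change of the rectangle masses.\<close>
  then show "\<forall>\<^sub>F n in F. dist (?I (\<pi> n)) (?I \<pi>') < e"
  proof eventually_elim
    case (elim n)
    with close[OF \<pi>[of n]] close[OF \<pi>'] \<open>0 < e\<close> show ?case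
      unfolding dist_real_def by linarith
  qed
qed

section \<open>Existence of a minimizing coupling\<close>

lemma pair_measure_in_couplings:
  assumes "prob_space P" "prob_space Q"
  shows "P \<Otimes>\<^sub>M Q \<in> couplings P Q"
proof -
  interpret P: prob_space P by fact
  interpret Q: prob_space Q by fact
  interpret PQ: pair_prob_space P Q ..
  have "distr (P \<Otimes>\<^sub>M Q) Q snd = Q"
  proof (rule measure_eqI)
    fix B assume "B \<in> sets (distr (P \<Otimes>\<^sub>M Q) Q snd)"
    then have B: "B \<in> sets Q" by simp
    have "snd -` B \<inter> space (P \<Otimes>\<^sub>M Q) = space P \<times> B"
      using sets.sets_into_space[OF B] by (auto simp: space_pair_measure)
    then show "emeasure (distr (P \<Otimes>\<^sub>M Q) Q snd) B = emeasure Q B"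
      using B by (simp add: emeasure_distr Q.emeasure_pair_measure_Times P.emeasure_space_1)
  qed simp
  then show ?thesis
    using Q.distr_pair_fst[of P] PQ.prob_space_axioms by (simp add: couplings_def)
qed

text \<open>Direct method. The product measure makes the set of values nonempty and the marginal
  second moments bound it below, so the infimum is a real number; along the filter \<open>F\<close>
  a minimizing sequence tends both to it and to the value at the limit coupling.\<close>

lemma coupling_inner_minimizer:
  fixes P :: "'a::polish_space measure" and Q :: "'b::polish_space measure"
    and \<phi> :: "'a \<Rightarrow> 'h::{real_inner, second_countable_topology}" and \<psi> :: "'b \<Rightarrow> 'h"
  assumes P: "prob_space P" "sets P = sets borel" and Q: "prob_space Q" "sets Q = sets borel"
    and \<phi>: "\<phi> \<in> borel_measurable P" "integrable P (\<lambda>x. (norm (\<phi> x))\<^sup>2)"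
    and \<psi>: "\<psi> \<in> borel_measurable Q" "integrable Q (\<lambda>y. (norm (\<psi> y))\<^sup>2)"
  shows "\<exists>\<pi>\<in>couplings P Q. \<forall>\<gamma>\<in>couplings P Q. (\<integral>z. inner (\<phi> (fst z)) (\<psi> (snd z)) \<partial>\<pi>)
      \<le> (\<integral>z. inner (\<phi> (fst z)) (\<psi> (snd z)) \<partial>\<gamma>)"
proof -
  let ?I = "\<lambda>\<gamma>. \<integral>z. inner (\<phi> (fst z)) (\<psi> (snd z)) \<partial>\<gamma>"
  define m where "m = Inf (?I ` couplings P Q)"
  have ne: "?I ` couplings P Q \<noteq> {}"
    using pair_measure_in_couplings[OF P(1) Q(1)] by blast
  have bdd: "bdd_below (?I ` couplings P Q)"
  proof (rule bdd_belowI2)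
    fix \<gamma> assume "\<gamma> \<in> couplings P Q"
    from coupling_inner_integrable(2)[OF this \<phi> \<psi>, of 1]
    show "- ((\<integral>x. (norm (\<phi> x))\<^sup>2 \<partial>P) / 2 + (\<integral>y. (norm (\<psi> y))\<^sup>2 \<partial>Q) / 2) \<le> ?I \<gamma>"
      by simp
  qed
  have m: "m \<le> ?I \<gamma>" if "\<gamma> \<in> couplings P Q" for \<gamma>
    unfolding m_def using that bdd by (intro cInf_lower) auto
  have "\<exists>\<gamma>\<in>couplings P Q. ?I \<gamma> < m + 1 / real (Suc n)" for n
    using cInf_lessD[OF ne, of "m + 1 / real (Suc n)"] by (auto simp: m_def)
  then obtain \<pi> where \<pi>: "\<And>n. \<pi> n \<in> couplings P Q" "\<And>n. ?I (\<pi> n) < m + 1 / real (Suc n)"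
    by metis
  have lim: "(\<lambda>n. ?I (\<pi> n)) \<longlonglongrightarrow> m"
  proof (rule tendsto_sandwich)
    show "\<forall>\<^sub>F n in sequentially. m \<le> ?I (\<pi> n)" using m \<pi>(1) by simp
    show "\<forall>\<^sub>F n in sequentially. ?I (\<pi> n) \<le> m + 1 / real (Suc n)"
      using \<pi>(2) by (simp add: less_imp_le)
    show "(\<lambda>n. m + 1 / real (Suc n)) \<longlonglongrightarrow> m"
      using tendsto_add[OF tendsto_const[of m] LIMSEQ_Suc[OF lim_1_over_n]] by simp
  qed simp
  obtain F \<pi>' where F: "F \<le> sequentially" "F \<noteq> bot" and \<pi>': "\<pi>' \<in> couplings P Q"
    and rect: "\<And>A B. A \<in> sets borel \<Longrightarrow> B \<in> sets borel \<Longrightarrow>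
      ((\<lambda>n. measure (\<pi> n) (A \<times> B)) \<longlongrightarrow> measure \<pi>' (A \<times> B)) F"
    using couplings_limit[where \<pi> = \<pi>, OF P Q \<pi>(1)] by metis
  have "((\<lambda>n. ?I (\<pi> n)) \<longlongrightarrow> ?I \<pi>') F"
    by (rule coupling_inner_tendsto[OF P Q \<pi>(1) \<pi>' rect \<phi> \<psi>])
  moreover have "((\<lambda>n. ?I (\<pi> n)) \<longlongrightarrow> m) F"
    by (rule tendsto_mono[OF F(1) lim])
  ultimately have "?I \<pi>' = m"
    by (rule tendsto_unique[OF F(2)])
  with m \<pi>' show ?thesis by auto
qed

section \<open>Second moments, reflection and transport cost\<close>

text \<open>\<open>P2\<close> controls the second moment about some base point \<open>x0\<close>;
  the inequality \<open>(a + b)\<^sup>2 \<le> 2 * (a\<^sup>2 + b\<^sup>2)\<close> moves it to the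
  origin, and \<open>S\<close> costs a factor \<open>K\<^sup>2\<close>.\<close>

lemma P2_bounded_linear_L2:
  fixes S :: "'h::{real_inner, second_countable_topology} \<Rightarrow> 'k::{real_inner, second_countable_topology}"
  assumes \<mu>: "\<mu> \<in> P2" and S: "bounded_linear S"
  shows "S \<in> borel_measurable \<mu>" and "integrable \<mu> (\<lambda>x. (norm (S x))\<^sup>2)"
proof -
  obtain x0 where prob: "prob_space \<mu>" and sets: "sets \<mu> = sets borel"
    and x0: "(\<integral>\<^sup>+ x. ennreal ((dist x x0)\<^sup>2) \<partial>\<mu>) < \<infinity>"
    using \<mu> by (auto simp: P2_def)
  interpret prob_space \<mu> by fact
  have "S \<in> borel_measurable borel"
    using S by (intro borel_measurable_continuous_onI linear_continuous_on)
  then show [measurable]: "S \<in> borel_measurable \<mu>"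
    using measurable_cong_sets[OF sets refl] by blast
  have [measurable]: "(\<lambda>x. dist x x0) \<in> borel_measurable \<mu>"
    unfolding measurable_cong_sets[OF sets refl] by measurable
  have "integrable \<mu> (\<lambda>x. (dist x x0)\<^sup>2)"
    using x0 by (intro integrableI_nonneg) auto
  moreover obtain K where K: "\<And>x. norm (S x) \<le> norm x * K"
    using bounded_linear.bounded[OF S] by blast
  ultimately have int: "integrable \<mu> (\<lambda>x. 2 * K\<^sup>2 * ((dist x x0)\<^sup>2 + (norm x0)\<^sup>2))"
    by simp
  have "(norm (S x))\<^sup>2 \<le> 2 * K\<^sup>2 * ((dist x x0)\<^sup>2 + (norm x0)\<^sup>2)" for x
  proof -
    have "norm x \<le> dist x x0 + norm x0"
      using norm_triangle_ineq[of "x - x0" x0] by (simp add: dist_norm)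
    then have "(norm x)\<^sup>2 \<le> (dist x x0 + norm x0)\<^sup>2"
      by (intro power_mono) auto
    also have "\<dots> \<le> 2 * ((dist x x0)\<^sup>2 + (norm x0)\<^sup>2)"
      using zero_le_power2[of "dist x x0 - norm x0"] by (simp add: power2_eq_square algebra_simps)
    finally have "(norm x)\<^sup>2 * K\<^sup>2 \<le> 2 * ((dist x x0)\<^sup>2 + (norm x0)\<^sup>2) * K\<^sup>2"
      by (intro mult_right_mono) auto
    moreover have "(norm (S x))\<^sup>2 \<le> (norm x * K)\<^sup>2"
      using K by (intro power_mono) auto
    ultimately show ?thesis by (simp add: power_mult_distrib algebra_simps)
  qed
  then show "integrable \<mu> (\<lambda>x. (norm (S x))\<^sup>2)"
    by (intro Bochner_Integration.integrable_bound[OF int]) (auto intro!: AE_I2)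
qed

lemma couplings_map_snd:
  assumes \<pi>: "\<pi> \<in> couplings P Q" and g: "g \<in> measurable Q R"
  shows "distr \<pi> (P \<Otimes>\<^sub>M R) (\<lambda>z. (fst z, g (snd z))) \<in> couplings P (distr Q R g)"
proof -
  note [measurable] = couplings_measurable[OF \<pi>] g
  interpret prob_space \<pi> using couplingsD(1)[OF \<pi>] .
  let ?h = "\<lambda>z. (fst z, g (snd z))"
  have h: "?h \<in> measurable \<pi> (P \<Otimes>\<^sub>M R)" by measurable
  have "distr (distr \<pi> (P \<Otimes>\<^sub>M R) ?h) P fst = P"
    using couplingsD(3)[OF \<pi>] by (simp add: distr_distr[OF _ h] comp_def)
  moreover have "distr (distr \<pi> (P \<Otimes>\<^sub>M R) ?h) (distr Q R g) snd = distr Q R g"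
  proof -
    have "distr (distr \<pi> (P \<Otimes>\<^sub>M R) ?h) (distr Q R g) snd = distr \<pi> R (\<lambda>z. g (snd z))"
      by (subst distr_distr[OF _ h]) (auto simp: comp_def intro: distr_cong)
    also have "\<dots> = distr (distr \<pi> Q snd) R g"
      by (simp add: distr_distr[OF g] comp_def)
    finally show ?thesis using couplingsD(4)[OF \<pi>] by simp
  qed
  ultimately show ?thesis
    using prob_space_distr[OF h] by (simp add: couplings_def cong: sets_pair_measure_cong)
qed

lemma distr_uminus_uminus:
  assumes "sets Q = sets (borel :: 'h::real_normed_vector measure)"
  shows "distr (distr Q borel uminus) borel uminus = Q"
proof -
  have "uminus \<in> measurable Q borel"
    unfolding measurable_cong_sets[OF assms refl] by (intro borel_measurable_continuous_onI continuous_intros)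
  then have "distr (distr Q borel uminus) borel uminus = distr Q borel (\<lambda>x. x)"
    by (subst distr_distr) (auto simp: comp_def intro!: borel_measurable_continuous_onI continuous_intros)
  also have "\<dots> = Q"
    using assms by (intro distr_id2) simp
  finally show ?thesis .
qed

text \<open>Expanding the square leaves the cross term as the only one that depends on the coupling
  beyond its marginals.\<close>

lemma coupling_transport_cost:
  fixes S :: "'a \<Rightarrow> 'h::{real_inner, second_countable_topology}" and R :: "'b \<Rightarrow> 'h"
  assumes \<gamma>: "\<gamma> \<in> couplings P Q"
    and S: "S \<in> borel_measurable P" "integrable P (\<lambda>x. (norm (S x))\<^sup>2)"
    and R: "R \<in> borel_measurable Q" "integrable Q (\<lambda>x. (norm (R x))\<^sup>2)"
  shows "(\<integral>\<^sup>+ (b, b'). ennreal ((norm (S b - R b'))\<^sup>2) \<partial>\<gamma>)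
    = ennreal ((\<integral>b. (norm (S b))\<^sup>2 \<partial>P) + (\<integral>b. (norm (R b))\<^sup>2 \<partial>Q)
        - 2 * (\<integral>(b, b'). inner (S b) (R b') \<partial>\<gamma>))"
proof -
  note int = couplings_marginal_integral(1)[OF \<gamma> S(2)] couplings_marginal_integral(3)[OF \<gamma> R(2)]
    coupling_inner_integrable(1)[OF \<gamma> S R]
  have eq: "(norm (S (fst z) - R (snd z)))\<^sup>2
      = (norm (S (fst z)))\<^sup>2 + (norm (R (snd z)))\<^sup>2 - 2 * inner (S (fst z)) (R (snd z))" for z
    by (simp add: power2_norm_eq_inner inner_diff inner_commute)
  have "(\<integral>\<^sup>+ (b, b'). ennreal ((norm (S b - R b'))\<^sup>2) \<partial>\<gamma>)
      = ennreal (\<integral>z. (norm (S (fst z) - R (snd z)))\<^sup>2 \<partial>\<gamma>)"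
    unfolding case_prod_unfold
  proof (rule nn_integral_eq_integral)
    show "integrable \<gamma> (\<lambda>z. (norm (S (fst z) - R (snd z)))\<^sup>2)"
      using int by (simp add: eq)
  qed simp
  also have "(\<integral>z. (norm (S (fst z) - R (snd z)))\<^sup>2 \<partial>\<gamma>)
      = (\<integral>b. (norm (S b))\<^sup>2 \<partial>P) + (\<integral>b. (norm (R b))\<^sup>2 \<partial>Q)
        - 2 * (\<integral>(b, b'). inner (S b) (R b') \<partial>\<gamma>)"
    using int S(1) R(1) couplings_marginal_integral(2)[OF \<gamma>, of "\<lambda>x. (norm (S x))\<^sup>2"]
      couplings_marginal_integral(4)[OF \<gamma>, of "\<lambda>x. (norm (R x))\<^sup>2"]
    by (simp add: eq case_prod_unfold)
  finally show ?thesis .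
qed

text \<open>Negating the second coordinate is a bijection between the couplings of \<open>P, Q\<close> and those of
  \<open>P\<close> with the reflected law of \<open>Q\<close>; it changes the sign of the inner product, so a minimizer of
  the inner product yields an optimal transport plan.\<close>

lemma kappa_lower_attained:
  fixes G :: "'h::{real_inner, polish_space} \<Rightarrow> 'h"
  assumes G: "positive_operator G" and P: "P \<in> P2" and Q: "Q \<in> P2"
  shows "\<exists>\<pi>\<in>couplings P Q. kappa G \<pi> = kappa_lower G P Q
    \<and> (\<forall>\<gamma>\<in>couplings P Q. kappa G \<pi> \<le> kappa G \<gamma>)"
proof -
  let ?S = "op_sqrt G" and ?Q = "distr Q borel uminus"
  let ?V = "weighted_moment G P" and ?W = "weighted_moment G Q"
  let ?flip = "\<lambda>\<gamma>. distr \<gamma> (P \<Otimes>\<^sub>M borel) (\<lambda>z. (fst z, - snd z))"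
  have S: "bounded_linear ?S"
    using positive_operator_op_sqrt[OF G] by (simp add: positive_operator_def)
  note SP = P2_bounded_linear_L2[OF P S] and SQ = P2_bounded_linear_L2[OF Q S]
  have S_uminus: "?S (- b) = - ?S b" for b
    by (rule linear_neg[OF bounded_linear.linear[OF S]])
  have prob: "prob_space P" "prob_space Q" and sets: "sets P = sets borel" "sets Q = sets borel"
    using P Q by (auto simp: P2_def)
  have uminus: "(uminus :: 'h \<Rightarrow> 'h) \<in> measurable N borel" if "sets N = sets borel" for N
    unfolding measurable_cong_sets[OF that refl]
    by (intro borel_measurable_continuous_onI continuous_intros)
  have kappa: "kappa G \<gamma> = (\<integral>z. inner (?S (fst z)) (?S (snd z)) \<partial>\<gamma>)" for \<gamma>
    by (simp add: kappa_def case_prod_unfold)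
  have S_borel: "?S \<in> borel_measurable borel"
    using S by (intro borel_measurable_continuous_onI linear_continuous_on)
  have SQ': "?S \<in> borel_measurable ?Q" "integrable ?Q (\<lambda>b. (norm (?S b))\<^sup>2)"
    using S_borel SQ(2) uminus[OF sets(2)] by (auto simp: integrable_distr_eq S_uminus)
  have W: "(\<integral>b. (norm (?S b))\<^sup>2 \<partial>?Q) = ?W"
    using S_borel uminus[OF sets(2)] by (simp add: integral_distr S_uminus weighted_moment_def)
  \<comment> \<open>The second marginal \<open>R\<close> is left general because the identity is
    applied both to couplings with \<open>Q\<close> and to couplings with \<open>?Q\<close>.\<close>
  have kappa_flip: "kappa G (?flip \<gamma>) = - kappa G \<gamma>" if "\<gamma> \<in> couplings P R" "sets R = sets borel" for \<gamma> R
  proof -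
    note [measurable] = couplings_measurable[OF that(1)] uminus[OF that(2)] S_borel SP(1)
    have "kappa G (?flip \<gamma>) = (\<integral>z. inner (?S (fst z)) (?S (- snd z)) \<partial>\<gamma>)"
      unfolding kappa by (subst integral_distr) simp_all
    then show ?thesis by (simp add: kappa S_uminus)
  qed
  \<comment> \<open>Reflecting the law \<open>?Q\<close> once more gives back
    \<open>Q\<close>.\<close>
  have flip: "?flip \<gamma> \<in> couplings P Q" if "\<gamma> \<in> couplings P ?Q" for \<gamma>
    using couplings_map_snd[OF that uminus] distr_uminus_uminus[OF sets(2)] by simp
  have flip': "?flip \<gamma> \<in> couplings P ?Q" if "\<gamma> \<in> couplings P Q" for \<gamma>
    by (rule couplings_map_snd[OF that uminus[OF sets(2)]])
  have cost: "(\<integral>\<^sup>+ (b, b'). ennreal ((norm (?S b - ?S b'))\<^sup>2) \<partial>\<gamma>) = ennreal (?V + ?W - 2 * kappa G \<gamma>)"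
    if "\<gamma> \<in> couplings P ?Q" for \<gamma>
    using coupling_transport_cost[OF that SP SQ'] by (simp add: W kappa_def weighted_moment_def)
  have "\<exists>\<pi>\<in>couplings P Q. \<forall>\<gamma>\<in>couplings P Q. kappa G \<pi> \<le> kappa G \<gamma>"
    unfolding kappa by (rule coupling_inner_minimizer[OF prob(1) sets(1) prob(2) sets(2) SP SQ])
  then obtain \<pi> where \<pi>: "\<pi> \<in> couplings P Q"
    and min: "\<And>\<gamma>. \<gamma> \<in> couplings P Q \<Longrightarrow> kappa G \<pi> \<le> kappa G \<gamma>"
    by blast
  have "(INF \<gamma>\<in>couplings P ?Q. \<integral>\<^sup>+ (b, b'). ennreal ((norm (?S b - ?S b'))\<^sup>2) \<partial>\<gamma>)
      = ennreal (?V + ?W + 2 * kappa G \<pi>)"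
  \<comment> \<open>The reflected minimizer is an admissible plan, which gives the upper bound;
    reflecting an arbitrary plan back to a coupling of \<open>P\<close> and \<open>Q\<close> gives
    the lower bound.\<close>
  proof (rule antisym)
    show "(INF \<gamma>\<in>couplings P ?Q. \<integral>\<^sup>+ (b, b'). ennreal ((norm (?S b - ?S b'))\<^sup>2) \<partial>\<gamma>)
        \<le> ennreal (?V + ?W + 2 * kappa G \<pi>)"
      by (rule INF_lower2[OF flip'[OF \<pi>]])
         (simp only: cost[OF flip'[OF \<pi>]] kappa_flip[OF \<pi> sets(2)], simp)
    show "ennreal (?V + ?W + 2 * kappa G \<pi>)
        \<le> (INF \<gamma>\<in>couplings P ?Q. \<integral>\<^sup>+ (b, b'). ennreal ((norm (?S b - ?S b'))\<^sup>2) \<partial>\<gamma>)"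
    proof (rule INF_greatest)
      fix \<gamma> assume \<gamma>: "\<gamma> \<in> couplings P ?Q"
      have "kappa G \<pi> \<le> - kappa G \<gamma>"
        using min[OF flip[OF \<gamma>]] kappa_flip[OF \<gamma>] by simp
      then show "ennreal (?V + ?W + 2 * kappa G \<pi>)
          \<le> (\<integral>\<^sup>+ (b, b'). ennreal ((norm (?S b - ?S b'))\<^sup>2) \<partial>\<gamma>)"
        unfolding cost[OF \<gamma>] by (intro ennreal_leI) simp
    qed
  qed
  \<comment> \<open>The embedding into the extended reals sends negative numbers to 0, so
    nonnegativity is required before \<open>enn2real\<close> can recover this value. It is Young's
    inequality with weight 1.\<close>
  moreover have "0 \<le> ?V + ?W + 2 * kappa G \<pi>"
    using coupling_inner_integrable(2)[OF \<pi> SP SQ, of 1] by (simp add: kappa weighted_moment_def)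
  ultimately have "W2_sq G P ?Q = ?V + ?W + 2 * kappa G \<pi>"
    unfolding W2_sq_def by simp
  then have "kappa G \<pi> = kappa_lower G P Q"
    by (simp add: kappa_lower_def)
  with \<pi> min show ?thesis by blast
qed

theorem theorem2:
  fixes \<Gamma> :: "'h::{real_inner, polish_space} \<Rightarrow> 'h"
    and t :: "'o::polish_space \<Rightarrow> 'h"
    and L :: real
    and \<U> :: "'u measure"
    and T :: "'o \<times> 'u \<Rightarrow> 'h"
    and M\<^sub>i :: "'m measure" and M\<^sub>j :: "'n measure"
    and X\<^sub>i :: "'m \<Rightarrow> 'o" and X\<^sub>j :: "'n \<Rightarrow> 'o"
    and U\<^sub>i :: "'m \<Rightarrow> 'u" and U\<^sub>j :: "'n \<Rightarrow> 'u"
    and C\<^sub>i C\<^sub>j :: "'o measure"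
    and \<epsilon>\<^sub>i \<epsilon>\<^sub>j :: "'o \<times> 'u \<Rightarrow> 'h"
    and \<tau>\<^sub>i \<tau>\<^sub>j :: real
    and P\<^sub>i P\<^sub>j :: "'h measure"
  assumes "positive_operator \<Gamma>"
    and "t \<in> measurable borel borel"
    and "borel_embedding (op_sqrt \<Gamma> \<circ> t)"
    and "L \<ge> 1"
    and "\<And>x y. inverse L * dist x y \<le> norm ((op_sqrt \<Gamma> \<circ> t) x - (op_sqrt \<Gamma> \<circ> t) y)"
    and "\<And>x y. norm ((op_sqrt \<Gamma> \<circ> t) x - (op_sqrt \<Gamma> \<circ> t) y) \<le> L * dist x y"
    and "T \<in> measurable (borel \<Otimes>\<^sub>M \<U>) borel"
    and "firm M\<^sub>i \<U> \<Gamma> t T C\<^sub>i X\<^sub>i U\<^sub>i \<epsilon>\<^sub>i \<tau>\<^sub>i P\<^sub>i"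
    and "firm M\<^sub>j \<U> \<Gamma> t T C\<^sub>j X\<^sub>j U\<^sub>j \<epsilon>\<^sub>j \<tau>\<^sub>j P\<^sub>j"
    and "distr M\<^sub>i \<U> U\<^sub>i = distr M\<^sub>j \<U> U\<^sub>j"
  shows "(\<forall>\<pi>\<in>couplings P\<^sub>i P\<^sub>j. kappa_lower \<Gamma> P\<^sub>i P\<^sub>j \<le> kappa \<Gamma> \<pi>) \<and>
         (\<exists>\<pi>\<in>couplings P\<^sub>i P\<^sub>j. kappa \<Gamma> \<pi> = kappa_lower \<Gamma> P\<^sub>i P\<^sub>j)"
  \<comment> \<open>The minimizing coupling has the value \<open>kappa_lower\<close>, and its
    minimality is the lower bound for all others.\<close>
  using kappa_lower_attained[OF assms(1) firm.P(2)[OF assms(8)] firm.P(2)[OF assms(9)]]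
  by fastforce

end
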